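(* Let $n\in\mathbb{N}$ and let $A\subset\mathbb{P}^2$ be a non-redundant decomposition of a form $T$ in three variables over $\mathbb{C}$ of degree $d=2n+8$. Let $r=\ell(A)$ and assume $r\leq 3n+11$. If the dimension of the Terracini's space of $A$ equals the expected dimension $3r-1$, then $A$ is minimal. Thus $T$ has rank $r=\ell(A)$ and it is identifiable.
   Context: We work over $\mathbb{C}$, and $\mathbb{N}$ includes $0$. A form $T$ of degree $d$ in $m+1$ variables is regarded as a point of $\mathbb{P}(\mathrm{Sym}^d(\mathbb{C}^{m+1}))$ (so $T\neq 0$, up to scaling). A point $P\in\mathbb{P}^m=\mathbb{P}(\mathbb{C}^{m+1})$ is identified with a linear form $L$ up to scaling, and the Veronese map $v_d:\mathbb{P}^m\to\mathbb{P}(\mathrm{Sym}^d(\mathbb{C}^{m+1}))$ sends $L$ to $L^d$. For a finite set $Z\subset\mathbb{P}^m$, $\ell(Z)$ is its cardinality. A finite set $A=\{P_1,\dots,P_r\}$ of $r$ distinct points of $\mathbb{P}^m$ is a decomposition of $T$, of length $\ell(A)=r$, if $T$ lies in the linear span $\langle v_d(A)\rangle$. It is non-redundant if $T\notin\langle v_d(A')\rangle$ for every proper subset $A'\subset A$. It is minimal if no decomposition of $T$ has length smaller than $r$. The rank of $T$ is the length of a minimal decomposition, and $T$ is identifiable if it has a unique minimal decomposition. The Terracini's space of a decomposition $A=\{P_1,\dots,P_r\}$ is the (projective) linear subspace of $\mathbb{P}(\mathrm{Sym}^d(\mathbb{C}^{m+1}))$ spanned by the projective tangent spaces to $v_d(\mathbb{P}^m)$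 at the points $v_d(P_1),\dots,v_d(P_r)$; if $P_i$ corresponds to the linear form $L_i$, it is the projectivization of the span of the forms $x_jL_i^{d-1}$, where the $x_j$ are the $m+1$ variables and $1\le i\le r$. Its (projective) dimension is at most $(m+1)r-1$. *)

theory Defs
  imports
    "HOL-Analysis.Analysis"
    "HOL-Library.Poly_Mapping"
begin

text \<open>
  Polynomials over the complex numbers in finitely many variables, indexed by a finite type
  \<open>'n\<close>: finitely supported functions from exponent vectors to coefficients, with the convolution
  product of \<open>HOL-Library.Poly_Mapping\<close>.  For forms in \<open>m + 1\<close> variables, \<open>CARD('n) = m + 1\<close>.
\<close>

type_synonym 'n cpoly = "('n \<Rightarrow>\<^sub>0 nat) \<Rightarrow>\<^sub>0 complex"

definition var :: "'n \<Rightarrow> 'n cpoly"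
  where "var j = Poly_Mapping.single (Poly_Mapping.single j 1) 1"

definition cscale :: "complex \<Rightarrow> 'n cpoly \<Rightarrow> 'n cpoly"
  where "cscale c p = Poly_Mapping.single 0 c * p"

global_interpretation cvs: vector_space cscale
  by unfold_locales
    (simp_all add: cscale_def distrib_left distrib_right single_add mult_single
      flip: mult.assoc)

text \<open>The space \<open>Sym\<^sup>d\<close> of forms of degree \<open>d\<close>, including 0.\<close>

definition forms :: "nat \<Rightarrow> ('n::finite) cpoly set"
  where "forms d = {p. \<forall>e \<in> Poly_Mapping.keys p. (\<Sum>j\<in>UNIV. Poly_Mapping.lookup e j) = d}"

text \<open>
  A point of a projective space is the corresponding one-dimensional linear subspace, and a
  projective linear subspace is represented by the linear subspace it comes from.  Points of
  \<open>\<bbbP>\<^sup>m\<close> are linear forms up to scaling.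
\<close>

definition proj :: "'n cpoly set \<Rightarrow> 'n cpoly set set"
  where "proj V = {cvs.span {v} |v. v \<in> V \<and> v \<noteq> 0}"

definition proj_dim :: "'n cpoly set \<Rightarrow> int"
  where "proj_dim V = int (cvs.dim V) - 1"

definition proj_points :: "('n::finite) cpoly set set"
  where "proj_points = proj (forms 1)"

text \<open>
  The representatives of a point \<open>[L]\<close> are the nonzero multiples of \<open>L\<close>; their \<open>d\<close>-th powers are
  multiples of \<open>L ^ d\<close>, so \<open>veronese d [L] = [L ^ d]\<close>, independently of the choice of \<open>L\<close>.
\<close>

definition veronese :: "nat \<Rightarrow> 'n cpoly set \<Rightarrow> 'n cpoly set"
  where "veronese d P = cvs.span {L ^ d |L. L \<in> P \<and> L \<noteq> 0}"

definition veronese_span :: "nat \<Rightarrow> 'n cpoly set set \<Rightarrow> 'n cpoly set"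
  where "veronese_span d A = cvs.span (\<Union>P\<in>A. veronese d P)"

definition decomposition :: "nat \<Rightarrow> ('n::finite) cpoly \<Rightarrow> 'n cpoly set set \<Rightarrow> bool"
  where "decomposition d T A \<longleftrightarrow> finite A \<and> A \<subseteq> proj_points \<and> T \<in> veronese_span d A"

definition non_redundant :: "nat \<Rightarrow> ('n::finite) cpoly \<Rightarrow> 'n cpoly set set \<Rightarrow> bool"
  where "non_redundant d T A \<longleftrightarrow> (\<forall>A'. A' \<subset> A \<longrightarrow> T \<notin> veronese_span d A')"

definition minimal_decomposition :: "nat \<Rightarrow> ('n::finite) cpoly \<Rightarrow> 'n cpoly set set \<Rightarrow> bool"
  where "minimal_decomposition d T A \<longleftrightarrow>
    decomposition d T A \<and> (\<forall>B. decomposition d T B \<longrightarrow> \<not> card B < card A)"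

definition form_rank :: "nat \<Rightarrow> ('n::finite) cpoly \<Rightarrow> nat"
  where "form_rank d T = (THE r. \<exists>A. minimal_decomposition d T A \<and> card A = r)"

definition identifiable :: "nat \<Rightarrow> ('n::finite) cpoly \<Rightarrow> bool"
  where "identifiable d T \<longleftrightarrow> (\<exists>!A. minimal_decomposition d T A)"

text \<open>
  The projective tangent space to the Veronese variety at \<open>[L ^ d]\<close>: the differential of
  \<open>L \<mapsto> L ^ d\<close> maps a linear form \<open>M\<close> to \<open>d L\<^bsup>d-1\<^esup> M\<close>, so for \<open>d \<ge> 1\<close> its image is spanned by
  the forms \<open>x\<^sub>j L\<^bsup>d-1\<^esup>\<close>.
\<close>

definition tangent_space :: "nat \<Rightarrow> 'n cpoly set \<Rightarrow> 'n cpoly set"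
  where "tangent_space d P = cvs.span {var j * L ^ (d - 1) |j L. L \<in> P \<and> L \<noteq> 0}"

definition terracini_space :: "nat \<Rightarrow> 'n cpoly set set \<Rightarrow> 'n cpoly set"
  where "terracini_space d A = cvs.span (\<Union>P\<in>A. tangent_space d P)"

end

theory Submission
  imports Defs
begin

text \<open>
  Suppose that \<open>B \<noteq> A\<close> is a decomposition with \<open>card B \<le> card A\<close>.  Subtracting the two expressions of
  \<open>T\<close> gives a relation \<open>\<Sum> c\<^sub>P L\<^sub>P\<^sup>d = 0\<close>, which by apolarity says \<open>\<Sum> c\<^sub>P F(P) = 0\<close> for all forms \<open>F\<close> of
  degree \<open>d\<close>; let \<open>W\<close> be its support.  Multiplying the \<open>c\<^sub>P\<close> by the values of a form of degree \<open>m\<close> gives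
  a relation in degree \<open>d - m\<close> supported off the corresponding curve (the Cayley-Bacharach property),
  and inductions on \<open>d\<close> show: if \<open>card W < 3 d\<close> then \<open>W\<close> lies on a conic; if \<open>card W \<le> 2 d + 1\<close> then \<open>W\<close> lies on
  a line; if \<open>card W \<le> d + 1\<close> then \<open>W\<close> is empty.  On the other hand, the hypothesis on the Terracini space
  implies that at most \<open>d\<close> points of \<open>A\<close> lie on a conic and at most \<open>(d + 1) / 2\<close> on a line.  As
  \<open>card W \<le> 2 card (W \<inter> A)\<close>, the three statements apply one after the other, starting from
  \<open>card W \<le> 2 r \<le> 6 n + 22 < 3 d\<close>, so \<open>W\<close> is empty.
\<close>

section \<open>Forms and their values\<close>

text \<open>Gaussian elimination, by induction on the set of equations: a pivot in the new equation
  \<open>i\<close> eliminates the unknown \<open>x p\<close> from the others, which leaves fewer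
  equations than unknowns.\<close>

lemma homogeneous_system_nontrivial_solution:
  fixes M :: "'i \<Rightarrow> 'j \<Rightarrow> 'a::field"
  assumes "finite I" "finite J" "card I < card J"
  shows "\<exists>x. (\<exists>j\<in>J. x j \<noteq> 0) \<and> (\<forall>i\<in>I. (\<Sum>j\<in>J. M i j * x j) = 0)"
  using assms
proof (induction I arbitrary: J M rule: finite_induct)
  case empty
  then show ?case by (intro exI[of _ "\<lambda>_. 1"]) (auto simp: card_gt_0_iff)
next
  case (insert i I)
  show ?case
  proof (cases "\<forall>j\<in>J. M i j = 0")
    case True
    have "card I < card J" using insert by simp
    then obtain x where "\<exists>j\<in>J. x j \<noteq> 0" "\<forall>i\<in>I. (\<Sum>j\<in>J. M i j * x j) = 0"
      using insert.IH[of J M] insert.prems by blast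
    then show ?thesis using True by (intro exI[of _ x]) auto
  next
    case False
    then obtain p where p: "p \<in> J" "M i p \<noteq> 0" by blast
    define J' where "J' = J - {p}"
    have J: "finite J'" "J = insert p J'" "p \<notin> J'" using insert.prems p by (auto simp: J'_def)
    have "card I < card J'" using insert J by simp
    then obtain x where x: "\<exists>j\<in>J'. x j \<noteq> 0"
      "\<forall>k\<in>I. (\<Sum>j\<in>J'. (M k j - M k p * M i j / M i p) * x j) = 0"
      using insert.IH[of J' "\<lambda>k j. M k j - M k p * M i j / M i p"] J(1) by blast
    define y where "y = x(p := - (\<Sum>j\<in>J'. M i j * x j) / M i p)"
    have y: "(\<Sum>j\<in>J. M k j * y j) = M k p * y p + (\<Sum>j\<in>J'. M k j * x j)" for k
    proof -
      have "(\<Sum>j\<in>J'. M k j * y j) = (\<Sum>j\<in>J'. M k j * x j)"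
        by (intro sum.cong) (use J(3) in \<open>auto simp: y_def\<close>)
      then show ?thesis using J by simp
    qed
    have "(\<Sum>j\<in>J. M k j * y j) = 0" if "k \<in> I" for k
    proof -
      have "0 = (\<Sum>j\<in>J'. (M k j - M k p * M i j / M i p) * x j)" using x(2) that by simp
      also have "\<dots> = (\<Sum>j\<in>J'. M k j * x j) - M k p / M i p * (\<Sum>j\<in>J'. M i j * x j)"
        unfolding sum_distrib_left sum_subtractf[symmetric] by (intro sum.cong refl) (simp add: algebra_simps)
      finally show ?thesis unfolding y by (simp add: y_def)
    qed
    moreover have "(\<Sum>j\<in>J. M i j * y j) = 0" unfolding y using p by (simp add: y_def)
    moreover have "\<exists>j\<in>J. y j \<noteq> 0" using x(1) J by (auto simp: y_def)
    ultimately show ?thesis by (intro exI[of _ y]) auto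
  qed
qed

text \<open>Linear extension of a function on exponent vectors. Evaluation, directional derivatives,
  single coefficients and the apolarity pairing are all instances, so additivity is proved once for
  all of them.\<close>

definition extend :: "(('n \<Rightarrow>\<^sub>0 nat) \<Rightarrow> complex) \<Rightarrow> 'n cpoly \<Rightarrow> complex"
  where "extend g F = (\<Sum>e\<in>Poly_Mapping.keys F. Poly_Mapping.lookup F e * g e)"

lemma extend_superset:
  assumes "finite S" "Poly_Mapping.keys F \<subseteq> S"
  shows "extend g F = (\<Sum>e\<in>S. Poly_Mapping.lookup F e * g e)"
  unfolding extend_def using assms
  by (intro sum.mono_neutral_left) (auto simp: in_keys_iff)

lemma extend_zero [simp]: "extend g 0 = 0"
  by (simp add: extend_def)

lemma extend_add: "extend g (F + G) = extend g F + extend g G"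
proof -
  let ?S = "Poly_Mapping.keys F \<union> Poly_Mapping.keys G"
  have "extend g (F + G) = (\<Sum>e\<in>?S. Poly_Mapping.lookup (F + G) e * g e)"
    by (rule extend_superset) (simp_all add: keys_add)
  also have "\<dots> = (\<Sum>e\<in>?S. Poly_Mapping.lookup F e * g e) + (\<Sum>e\<in>?S. Poly_Mapping.lookup G e * g e)"
    by (simp add: lookup_add distrib_right sum.distrib)
  also have "\<dots> = extend g F + extend g G"
    by (simp flip: extend_superset)
  finally show ?thesis .
qed

lemma extend_sum: "extend g (\<Sum>i\<in>I. F i) = (\<Sum>i\<in>I. extend g (F i))"
  by (induction I rule: infinite_finite_induct) (auto simp: extend_add)

lemma extend_single [simp]: "extend g (Poly_Mapping.single e c) = c * g e"
  by (cases "c = 0") (auto simp: extend_def)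

lemma cpoly_expand:
  "(F :: 'n cpoly) = (\<Sum>e\<in>Poly_Mapping.keys F. Poly_Mapping.single e (Poly_Mapping.lookup F e))"
proof (rule poly_mapping_eqI)
  fix k
  have "(\<Sum>e\<in>Poly_Mapping.keys F. Poly_Mapping.lookup (Poly_Mapping.single e (Poly_Mapping.lookup F e)) k)
      = (\<Sum>e\<in>Poly_Mapping.keys F. if e = k then Poly_Mapping.lookup F e else 0)"
    by (intro sum.cong) (auto simp: lookup_single when_def)
  then show "Poly_Mapping.lookup F k =
      Poly_Mapping.lookup (\<Sum>e\<in>Poly_Mapping.keys F. Poly_Mapping.single e (Poly_Mapping.lookup F e)) k"
    by (simp add: lookup_sum in_keys_iff)
qed

lemma extend_mult:
  "extend g (F * G) = (\<Sum>e\<in>Poly_Mapping.keys F. \<Sum>f\<in>Poly_Mapping.keys G.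
     Poly_Mapping.lookup F e * Poly_Mapping.lookup G f * g (e + f))"
proof -
  have "F * G = (\<Sum>e\<in>Poly_Mapping.keys F. \<Sum>f\<in>Poly_Mapping.keys G.
     Poly_Mapping.single (e + f) (Poly_Mapping.lookup F e * Poly_Mapping.lookup G f))"
    by (subst cpoly_expand[of F], subst cpoly_expand[of G]) (simp add: sum_product mult_single)
  then show ?thesis by (simp add: extend_sum)
qed

lemma cscale_single [simp]:
  "cscale c (Poly_Mapping.single e b) = Poly_Mapping.single e (c * b)"
  by (simp add: cscale_def mult_single)

lemma lookup_cscale [simp]: "Poly_Mapping.lookup (cscale c F) e = c * Poly_Mapping.lookup F e"
proof -
  have "cscale c F = Poly_Mapping.map ((*) c) F"
    by (simp add: cscale_def mult_map_scale_conv_mult)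
  then show ?thesis by (simp add: Poly_Mapping.map.rep_eq when_def)
qed

lemma extend_cscale: "extend g (cscale c F) = c * extend g F"
proof -
  have "Poly_Mapping.keys (cscale c F) \<subseteq> Poly_Mapping.keys F" by (auto simp: in_keys_iff)
  then show ?thesis
    by (subst extend_superset[of "Poly_Mapping.keys F"])
      (auto simp: extend_def sum_distrib_left mult_ac)
qed

section \<open>Evaluation at a vector and directional derivatives\<close>

definition mon :: "('n::finite \<Rightarrow> complex) \<Rightarrow> ('n \<Rightarrow>\<^sub>0 nat) \<Rightarrow> complex"
  where "mon v e = (\<Prod>j\<in>UNIV. v j ^ Poly_Mapping.lookup e j)"

abbreviation ev :: "('n::finite \<Rightarrow> complex) \<Rightarrow> 'n cpoly \<Rightarrow> complex"
  where "ev v \<equiv> extend (mon v)"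

text \<open>The derivative at \<open>v\<close> in the direction \<open>t\<close> of the monomial
  with exponent vector \<open>e\<close>. Truncated subtraction at a zero entry is harmless, because
  the factor \<open>of_nat\<close> of that entry vanishes.\<close>

definition dmon :: "('n::finite \<Rightarrow> complex) \<Rightarrow> ('n \<Rightarrow> complex) \<Rightarrow> ('n \<Rightarrow>\<^sub>0 nat) \<Rightarrow> complex"
  where "dmon t v e = (\<Sum>j\<in>UNIV. t j * of_nat (Poly_Mapping.lookup e j) * mon v (e - Poly_Mapping.single j 1))"

lemma mon_zero [simp]: "mon v 0 = 1"
  by (simp add: mon_def)

lemma mon_add: "mon v (e + f) = mon v e * mon v f"
  by (simp add: mon_def lookup_add power_add prod.distrib)

lemma mon_single [simp]: "mon v (Poly_Mapping.single j k) = v j ^ k"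
proof -
  have "mon v (Poly_Mapping.single j k) = (\<Prod>i\<in>UNIV. if i = j then v i ^ k else 1)"
    unfolding mon_def by (intro prod.cong) (auto simp: lookup_single when_def)
  then show ?thesis by simp
qed

lemma monomial_split:
  assumes "Poly_Mapping.lookup e j > 0"
  shows "e = (e - Poly_Mapping.single j 1) + Poly_Mapping.single j (1::nat)"
  by (rule poly_mapping_eqI) (use assms in \<open>auto simp: lookup_add lookup_minus lookup_single when_def\<close>)

lemma dmon_add: "dmon t v (e + f) = dmon t v e * mon v f + mon v e * dmon t v f"
proof -
  \<comment> \<open>Truncated subtraction passes through the sum only if \<open>a\<close> has a
    positive entry at \<open>j\<close>; otherwise both sides are 0.\<close>
  have *: "of_nat (Poly_Mapping.lookup a j) * mon v (a + b - Poly_Mapping.single j 1)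
    = of_nat (Poly_Mapping.lookup a j) * mon v (a - Poly_Mapping.single j 1) * mon v b"
    for a b :: "'a \<Rightarrow>\<^sub>0 nat" and j
  proof (cases "Poly_Mapping.lookup a j > 0")
    case True
    have "a + b - Poly_Mapping.single j 1 = (a - Poly_Mapping.single j 1) + b"
      by (rule poly_mapping_eqI)
        (use True in \<open>auto simp: lookup_add lookup_minus lookup_single when_def\<close>)
    then show ?thesis by (simp add: mon_add)
  qed simp
  have **: "t j * of_nat (Poly_Mapping.lookup (e + f) j) * mon v (e + f - Poly_Mapping.single j 1)
    = t j * of_nat (Poly_Mapping.lookup e j) * mon v (e - Poly_Mapping.single j 1) * mon v f
    + mon v e * (t j * of_nat (Poly_Mapping.lookup f j) * mon v (f - Poly_Mapping.single j 1))" for j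
  proof -
    have "t j * of_nat (Poly_Mapping.lookup (e + f) j) * mon v (e + f - Poly_Mapping.single j 1)
      = t j * (of_nat (Poly_Mapping.lookup e j) * mon v (e + f - Poly_Mapping.single j 1))
      + t j * (of_nat (Poly_Mapping.lookup f j) * mon v (f + e - Poly_Mapping.single j 1))"
      by (simp add: lookup_add algebra_simps)
    then show ?thesis unfolding * by (simp only: mult_ac)
  qed
  show ?thesis
    unfolding dmon_def ** by (simp add: sum.distrib sum_distrib_left sum_distrib_right)
qed

lemma ev_mult: "ev v (F * G) = ev v F * ev v G"
  unfolding extend_mult unfolding extend_def sum_product by (intro sum.cong refl) (simp add: mon_add mult_ac)

lemma ev_one [simp]: "ev v 1 = 1"
  by (simp flip: single_one)

lemma deriv_mult:
  "extend (dmon t v) (F * G) = extend (dmon t v) F * ev v G + ev v F * extend (dmon t v) G"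
proof -
  have "extend (dmon t v) F * ev v G = (\<Sum>e\<in>Poly_Mapping.keys F. \<Sum>f\<in>Poly_Mapping.keys G.
     Poly_Mapping.lookup F e * Poly_Mapping.lookup G f * (dmon t v e * mon v f))"
    unfolding extend_def sum_product by (intro sum.cong refl) (simp add: mult_ac)
  moreover have "ev v F * extend (dmon t v) G = (\<Sum>e\<in>Poly_Mapping.keys F. \<Sum>f\<in>Poly_Mapping.keys G.
     Poly_Mapping.lookup F e * Poly_Mapping.lookup G f * (mon v e * dmon t v f))"
    unfolding extend_def sum_product by (intro sum.cong refl) (simp add: mult_ac)
  ultimately show ?thesis
    by (simp add: extend_mult dmon_add distrib_left sum.distrib)
qed

section \<open>The space of forms of a given degree and its dimension\<close>

definition linear_form :: "('n::finite \<Rightarrow> complex) \<Rightarrow> 'n cpoly"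
  where "linear_form a = (\<Sum>j\<in>UNIV. cscale (a j) (var j))"

definition exponents :: "nat \<Rightarrow> ('n::finite \<Rightarrow>\<^sub>0 nat) set"
  where "exponents d = {e. (\<Sum>j\<in>UNIV. Poly_Mapping.lookup e j) = d}"

lemma ev_linear_form: "ev v (linear_form a) = (\<Sum>j\<in>UNIV. a j * v j)"
  by (simp add: linear_form_def extend_sum extend_cscale var_def)

lemma forms_iff: "F \<in> forms d \<longleftrightarrow> Poly_Mapping.keys F \<subseteq> exponents d"
  by (auto simp: forms_def exponents_def)

lemma forms_zero [simp]: "0 \<in> forms d"
  by (simp add: forms_iff)

lemma forms_add: "F \<in> forms d \<Longrightarrow> G \<in> forms d \<Longrightarrow> F + G \<in> forms d"
  using keys_add[of F G] by (auto simp: forms_iff)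

lemma forms_cscale: "F \<in> forms d \<Longrightarrow> cscale c F \<in> forms d"
  by (auto simp: forms_iff in_keys_iff)

lemma forms_sum: "(\<And>i. i \<in> I \<Longrightarrow> F i \<in> forms d) \<Longrightarrow> (\<Sum>i\<in>I. F i) \<in> forms d"
  by (induction I rule: infinite_finite_induct) (auto intro: forms_add)

lemma forms_subspace: "cvs.subspace (forms d)"
  by (auto simp: cvs.subspace_def intro: forms_add forms_cscale)

lemma exponents_add: "e \<in> exponents k \<Longrightarrow> f \<in> exponents m \<Longrightarrow> e + f \<in> exponents (k + m)"
  by (simp add: exponents_def lookup_add sum.distrib)

lemma forms_mult: "F \<in> forms k \<Longrightarrow> G \<in> forms m \<Longrightarrow> F * G \<in> forms (k + m)"
  using keys_mult[of F G] exponents_add by (fastforce simp: forms_iff)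

lemma var_forms: "var j \<in> forms 1"
proof -
  have "(\<Sum>i\<in>UNIV. Poly_Mapping.lookup (Poly_Mapping.single j (1::nat)) i) = (\<Sum>i\<in>UNIV. if i = j then 1 else 0)"
    by (intro sum.cong) (auto simp: lookup_single when_def)
  then show ?thesis by (simp add: var_def forms_iff exponents_def)
qed

lemma linear_form_forms: "linear_form a \<in> forms 1"
  unfolding linear_form_def by (intro forms_sum forms_cscale var_forms)

lemma one_forms: "1 \<in> forms 0"
  by (simp add: forms_iff exponents_def)

lemma power_forms: "F \<in> forms 1 \<Longrightarrow> F ^ k \<in> forms k"
  by (induction k) (auto simp: one_forms intro: forms_mult[of _ 1, simplified])

lemma single_forms: "e \<in> exponents d \<Longrightarrow> Poly_Mapping.single e c \<in> forms d"
  by (auto simp: forms_iff)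

text \<open>The first two exponents, subject to \<open>a + b \<le> d\<close>, determine the third;
  this counts the monomials of degree \<open>d\<close> in three variables.\<close>

lemma exponents_bij:
  "bij_betw (\<lambda>(a, b). Poly_Mapping.single (1::3) a + Poly_Mapping.single 2 b + Poly_Mapping.single 3 (d - a - b))
     (SIGMA a:{..d}. {..d - a}) (exponents d)"
proof -
  define E where "E a b = Poly_Mapping.single (1::3) a + Poly_Mapping.single 2 b
    + Poly_Mapping.single 3 (d - a - b)" for a b
  have "(1::3) \<noteq> 2" "(1::3) \<noteq> 3" "(2::3) \<noteq> 3" by simp_all
  then have E: "Poly_Mapping.lookup (E a b) 1 = a" "Poly_Mapping.lookup (E a b) 2 = b"
    "Poly_Mapping.lookup (E a b) 3 = d - a - b" for a b
    unfolding E_def lookup_add by (auto simp only: lookup_single when_def) auto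
  have eq: "e = E (Poly_Mapping.lookup e 1) (Poly_Mapping.lookup e 2)" if "e \<in> exponents d" for e
  proof (rule poly_mapping_eqI)
    fix k :: 3
    have "Poly_Mapping.lookup e 1 + Poly_Mapping.lookup e 2 + Poly_Mapping.lookup e 3 = d"
      using that unfolding exponents_def sum_3 by blast
    then show "Poly_Mapping.lookup e k = Poly_Mapping.lookup (E (Poly_Mapping.lookup e 1) (Poly_Mapping.lookup e 2)) k"
      using exhaust_3[of k] E by (elim disjE) auto
  qed
  have "bij_betw (\<lambda>(a, b). E a b) (SIGMA a:{..d}. {..d - a}) (exponents d)"
  proof (rule bij_betwI[where g = "\<lambda>e :: 3 \<Rightarrow>\<^sub>0 nat. (Poly_Mapping.lookup e 1, Poly_Mapping.lookup e 2)"])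
    show "(\<lambda>(a, b). E a b) \<in> (SIGMA a:{..d}. {..d - a}) \<rightarrow> exponents d"
      unfolding exponents_def sum_3 by (auto simp only: E Pi_iff mem_Sigma_iff atMost_iff mem_Collect_eq split: prod.splits)
    show "(\<lambda>e :: 3 \<Rightarrow>\<^sub>0 nat. (Poly_Mapping.lookup e 1, Poly_Mapping.lookup e 2)) \<in> exponents d \<rightarrow> (SIGMA a:{..d}. {..d - a})"
      unfolding exponents_def sum_3 by auto
  qed (use E eq in auto)
  then show ?thesis unfolding E_def .
qed

lemma card_exponents: "card (exponents d :: (3 \<Rightarrow>\<^sub>0 nat) set) = (\<Sum>a\<le>d. d - a + 1)"
  using bij_betw_same_card[OF exponents_bij[of d]] by simp

lemma finite_exponents: "finite (exponents d :: (3 \<Rightarrow>\<^sub>0 nat) set)"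
  using bij_betw_finite[OF exponents_bij[of d]] by simp

lemma card_exponents_Suc:
  "card (exponents (Suc d) :: (3 \<Rightarrow>\<^sub>0 nat) set) = card (exponents d :: (3 \<Rightarrow>\<^sub>0 nat) set) + d + 2"
  unfolding card_exponents sum.atMost_Suc_shift by simp

lemma card_exponents_1: "card (exponents 1 :: (3 \<Rightarrow>\<^sub>0 nat) set) = 3"
  by (simp add: card_exponents)

lemma card_exponents_2: "card (exponents 2 :: (3 \<Rightarrow>\<^sub>0 nat) set) = 6"
  by (simp add: card_exponents numeral_2_eq_2)

text \<open>Vanishing at a vector is one linear condition on the coefficients, and there are fewer
  conditions than coefficients.\<close>

lemma exists_form_vanishing:
  fixes X :: "(3 \<Rightarrow> complex) set"
  assumes "finite X" "card X < card (exponents k :: (3 \<Rightarrow>\<^sub>0 nat) set)"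
  shows "\<exists>F\<in>forms k. F \<noteq> 0 \<and> (\<forall>v\<in>X. ev v F = 0)"
proof -
  obtain x where x: "\<exists>e\<in>exponents k. x e \<noteq> 0" "\<forall>v\<in>X. (\<Sum>e\<in>exponents k. mon v e * x e) = 0"
    using homogeneous_system_nontrivial_solution[OF assms(1) finite_exponents assms(2)] by metis
  define F where "F = (\<Sum>e\<in>exponents k. Poly_Mapping.single e (x e))"
  have "Poly_Mapping.lookup F e = x e" if "e \<in> exponents k" for e
  proof -
    have "Poly_Mapping.lookup F e = (\<Sum>f\<in>exponents k. if f = e then x f else 0)"
      unfolding F_def lookup_sum by (intro sum.cong) (auto simp: lookup_single when_def)
    then show ?thesis using that finite_exponents by simp
  qed
  then have "F \<noteq> 0" using x(1) by auto
  moreover have "F \<in> forms k" unfolding F_def by (intro forms_sum single_forms)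
  moreover have "ev v F = 0" if "v \<in> X" for v
    using x(2) that by (simp add: F_def extend_sum mult.commute)
  ultimately show ?thesis by blast
qed

lemma two_independent_solutions:
  fixes M :: "'i \<Rightarrow> 'j \<Rightarrow> 'a::field"
  assumes "finite I" "finite J" "card I + 1 < card J"
  obtains x y j where "\<forall>i\<in>I. (\<Sum>j\<in>J. M i j * x j) = 0" "\<forall>i\<in>I. (\<Sum>j\<in>J. M i j * y j) = 0"
    "j \<in> J" "x j \<noteq> 0" "y j = 0" "\<exists>j\<in>J. y j \<noteq> 0"
proof -
  have "card I < card J" using assms(3) by simp
  then obtain x j where x: "\<forall>i\<in>I. (\<Sum>j\<in>J. M i j * x j) = 0" and j: "j \<in> J" "x j \<noteq> 0"
    using homogeneous_system_nontrivial_solution[OF assms(1,2), of M] by blast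
  \<comment> \<open>The extra row \<open>None\<close> imposes \<open>y j = 0\<close>. As
    \<open>x j \<noteq> 0\<close>, the nonzero solution \<open>y\<close> is then not a multiple of
    \<open>x\<close>.\<close>
  define N where "N i' k = (case i' of None \<Rightarrow> (if k = j then 1 else 0) | Some i \<Rightarrow> M i k)" for i' k
  have "card (insert None (Some ` I)) < card J"
    using assms by (simp add: card_image)
  then obtain y where y: "\<exists>j\<in>J. y j \<noteq> 0"
    "\<forall>i\<in>insert None (Some ` I). (\<Sum>j\<in>J. N i j * y j) = 0"
    using homogeneous_system_nontrivial_solution[of "insert None (Some ` I)" J N] assms(1,2) by blast
  have "(\<Sum>k\<in>J. N None k * y k) = (\<Sum>k\<in>J. if k = j then y k else 0)"
    by (intro sum.cong) (auto simp: N_def)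
  then have "y j = 0" using y(2) j assms(2) by simp
  moreover have "\<forall>i\<in>I. (\<Sum>j\<in>J. M i j * y j) = 0"
    using y(2) by (simp add: N_def)
  ultimately show ?thesis using that x j y(1) by blast
qed

section \<open>Linear forms as functions on vectors\<close>

definition dot :: "('n::finite \<Rightarrow> complex) \<Rightarrow> ('n \<Rightarrow> complex) \<Rightarrow> complex"
  where "dot a v = (\<Sum>j\<in>UNIV. a j * v j)"

lemma dot_add_right: "dot a (\<lambda>j. u j + v j) = dot a u + dot a v"
  by (simp add: dot_def distrib_left sum.distrib)

lemma dot_diff_scale_left: "dot (\<lambda>j. a j - c * b j) v = dot a v - c * dot b v"
  unfolding dot_def sum_distrib_left sum_subtractf[symmetric]
  by (intro sum.cong refl) (simp add: algebra_simps)

lemma dot_unit: "dot a (\<lambda>j. if j = i then c else 0) = a i * c"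
proof -
  have "dot a (\<lambda>j. if j = i then c else 0) = (\<Sum>j\<in>UNIV. if j = i then a j * c else 0)"
    unfolding dot_def by (intro sum.cong) auto
  then show ?thesis by simp
qed

lemma dot_kernel_imp_proportional:
  assumes "a i \<noteq> 0" "\<And>v. dot a v = 0 \<Longrightarrow> dot b v = 0"
  shows "b = (\<lambda>j. b i / a i * a j)"
proof
  fix j
  \<comment> \<open>A combination of the unit vectors at \<open>i\<close> and \<open>j\<close> that
    lies in the kernel of \<open>a\<close>.\<close>
  define v where "v = (\<lambda>k. (if k = i then a j else 0) + (if k = j then - a i else 0))"
  have "dot a v = 0" "dot b v = b i * a j - b j * a i"
    unfolding v_def dot_add_right dot_unit by simp_all
  then have "b i * a j = b j * a i" using assms(2) by force
  then show "b j = b i / a i * a j" using assms(1) by (simp add: field_simps)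
qed

text \<open>If both factors were nonzero, the sum of two unit vectors, one detected by each factor,
  would give a nonzero product.\<close>

lemma dot_mult_eq_zero:
  assumes "\<And>v. dot a v * dot b v = 0" "a i \<noteq> 0"
  shows "b = (\<lambda>_. 0)"
proof (rule ccontr)
  assume "b \<noteq> (\<lambda>_. 0)"
  then obtain j where j: "b j \<noteq> 0" by auto
  define u where "u = (\<lambda>k. if k = i then 1 else (0::complex))"
  define w where "w = (\<lambda>k. if k = j then 1 else (0::complex))"
  have "dot a u \<noteq> 0" "dot b w \<noteq> 0" using assms(2) j by (auto simp: u_def w_def dot_unit)
  moreover from this have "dot b u = 0" "dot a w = 0" using assms(1) by fastforce+
  ultimately show False using assms(1)[of "\<lambda>k. u k + w k"] by (simp add: dot_add_right)
qed

text \<open>Unique factorization for products of two linear forms. The kernel of \<open>a\<close> is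
  not a union of two proper subspaces, so \<open>b\<close> or \<open>a'\<close> vanishes on it; in
  the second case the common factor \<open>a\<close> cancels.\<close>

lemma dot_mult_eq:
  assumes eq: "\<And>v. dot a v * dot b' v = dot b v * dot a' v" and "a \<noteq> (\<lambda>_. 0)"
  shows "(\<exists>c. b = (\<lambda>j. c * a j)) \<or> (\<exists>c. a' = (\<lambda>j. c * a j) \<and> b' = (\<lambda>j. c * b j))"
proof -
  obtain i where i: "a i \<noteq> 0" using assms(2) by auto
  have "(\<forall>v. dot a v = 0 \<longrightarrow> dot b v = 0) \<or> (\<forall>v. dot a v = 0 \<longrightarrow> dot a' v = 0)"
  proof (rule ccontr)
    assume "\<not> ?thesis"
    then obtain u w where u: "dot a u = 0" "dot b u \<noteq> 0" and w: "dot a w = 0" "dot a' w \<noteq> 0"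
      by blast
    have "dot a' u = 0" "dot b w = 0" using eq[of u] eq[of w] u w by auto
    then show False using eq[of "\<lambda>k. u k + w k"] u w by (simp add: dot_add_right)
  qed
  then consider "\<And>v. dot a v = 0 \<Longrightarrow> dot b v = 0" | "\<And>v. dot a v = 0 \<Longrightarrow> dot a' v = 0"
    by blast
  then show ?thesis
  proof cases
    case 1
    then show ?thesis using dot_kernel_imp_proportional[of a i b] i 1 by blast
  next
    case 2
    define c where "c = a' i / a i"
    have a': "a' = (\<lambda>j. c * a j)" using dot_kernel_imp_proportional[of a i a'] i 2 by (simp add: c_def)
    have "dot a' v = c * dot a v" for v
      unfolding a' dot_def by (simp add: sum_distrib_left mult_ac)
    then have "dot a v * dot (\<lambda>j. b' j - c * b j) v = 0" for v
      using eq[of v] by (simp add: dot_diff_scale_left algebra_simps)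
    from dot_mult_eq_zero[OF this i] have "b' = (\<lambda>j. c * b j)" by (simp add: fun_eq_iff)
    then show ?thesis using a' by blast
  qed
qed

lemma ev_linear_form_dot: "ev v (linear_form a) = dot a v"
  by (simp add: ev_linear_form dot_def)

lemma linear_form_nonzero: "a \<noteq> (\<lambda>_. 0) \<Longrightarrow> linear_form a \<noteq> 0"
proof
  assume "a \<noteq> (\<lambda>_. 0)" "linear_form a = 0"
  then obtain i where "a i \<noteq> 0" by auto
  then show False
    using \<open>linear_form a = 0\<close> ev_linear_form_dot[of "\<lambda>j. if j = i then 1 else 0" a] by (simp add: dot_unit)
qed

section \<open>Linear relations between the values of forms at points of the plane\<close>

text \<open>Finitely many points of the projective plane, each given by one coordinate vector; the
  last assumption says that distinct vectors give distinct points.\<close>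

locale point_set =
  fixes X :: "(3 \<Rightarrow> complex) set"
  assumes finite_X: "finite X"
    and nonzero: "v \<in> X \<Longrightarrow> v \<noteq> (\<lambda>_. 0)"
    and not_proportional: "u \<in> X \<Longrightarrow> v \<in> X \<Longrightarrow> v = (\<lambda>j. c * u j) \<Longrightarrow> u = v"
begin

text \<open>The linear dependencies among the evaluations of degree \<open>k\<close> forms at
  \<open>X\<close>; by apolarity, the dependencies among the powers
  \<open>linear_form v ^ k\<close>.\<close>

definition rel :: "nat \<Rightarrow> ((3 \<Rightarrow> complex) \<Rightarrow> complex) \<Rightarrow> bool"
  where "rel k c \<longleftrightarrow> (\<forall>F\<in>forms k. (\<Sum>v\<in>X. c v * ev v F) = 0)"

definition supp :: "((3 \<Rightarrow> complex) \<Rightarrow> complex) \<Rightarrow> (3 \<Rightarrow> complex) set"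
  where "supp c = {v \<in> X. c v \<noteq> 0}"

lemma finite_supp [simp]: "finite (supp c)"
  using finite_X by (simp add: supp_def)

text \<open>This trades degree for support: the new relation has lower degree and loses the points
  on the curve \<open>F = 0\<close>. The inductions on the degree rest on it.\<close>

lemma rel_mult:
  assumes "rel (k + m) c" "F \<in> forms m"
  shows "rel k (\<lambda>v. c v * ev v F)"
  unfolding rel_def
proof
  fix G :: "3 cpoly"
  assume "G \<in> forms k"
  then have "(\<Sum>v\<in>X. c v * ev v (G * F)) = 0"
    using assms forms_mult[of G k F m] by (simp add: rel_def)
  then show "(\<Sum>v\<in>X. c v * ev v F * ev v G) = 0" by (simp add: ev_mult mult_ac)
qed

lemma rel_linear_combination:
  assumes "rel k c" "rel k c'"
  shows "rel k (\<lambda>v. a * c v + b * c' v)"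
  unfolding rel_def
proof
  fix F :: "3 cpoly"
  assume "F \<in> forms k"
  have "(\<Sum>v\<in>X. (a * c v + b * c' v) * ev v F)
      = a * (\<Sum>v\<in>X. c v * ev v F) + b * (\<Sum>v\<in>X. c' v * ev v F)"
    unfolding sum_distrib_left sum.distrib[symmetric] by (intro sum.cong refl) (simp add: algebra_simps)
  then show "(\<Sum>v\<in>X. (a * c v + b * c' v) * ev v F) = 0"
    using assms \<open>F \<in> forms k\<close> by (simp add: rel_def)
qed

lemma supp_mult: "supp (\<lambda>v. c v * ev v F) = {v \<in> supp c. ev v F \<noteq> 0}"
  by (auto simp: supp_def)

lemma card_supp_mult:
  "card (supp c) = card (supp (\<lambda>v. c v * ev v F)) + card {v \<in> supp c. ev v F = 0}"
  unfolding supp_mult by (subst card_Un_disjoint[symmetric]) (auto intro: arg_cong[where f = card])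

lemma nonvanishing_linear_form:
  assumes "u \<in> X"
  obtains L where "L \<in> forms 1" "ev u L \<noteq> 0"
proof -
  obtain i where "u i \<noteq> 0" using nonzero[OF assms] by auto
  then have "ev u (var i) \<noteq> 0" by (simp add: var_def)
  then show ?thesis using that var_forms by blast
qed

lemma separating_linear_form:
  assumes "u \<in> X" "v \<in> X" "u \<noteq> v"
  obtains L where "L \<in> forms 1" "ev u L \<noteq> 0" "ev v L = 0"
proof -
  obtain i where i: "v i \<noteq> 0" using nonzero[OF assms(2)] by auto
  have "\<exists>j. v i * u j \<noteq> v j * u i"
  proof (rule ccontr)
    assume "\<nexists>j. v i * u j \<noteq> v j * u i"
    then have "u = (\<lambda>j. u i / v i * v j)" using i by (auto simp: fun_eq_iff field_simps)
    then show False using not_proportional assms by metis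
  qed
  then obtain j where j: "v i * u j \<noteq> v j * u i" by blast
  \<comment> \<open>The form \<open>v i * x_j - v j * x_i\<close>, whose value at \<open>u\<close>
    is nonzero by the choice of \<open>j\<close>.\<close>
  define L where "L = linear_form (\<lambda>k. (if k = j then v i else 0) + (if k = i then - v j else 0))"
  have "ev w L = v i * w j - v j * w i" for w
    unfolding L_def ev_linear_form_dot
    using dot_add_right[of w "\<lambda>k. if k = j then v i else 0" "\<lambda>k. if k = i then - v j else 0"]
    unfolding dot_unit by (simp add: dot_def mult.commute)
  then have "ev u L \<noteq> 0" "ev v L = 0" using j by auto
  then show ?thesis using that linear_form_forms unfolding L_def by blast
qed

text \<open>Fix a support point \<open>u\<close>. A linear form through another support point that
  misses \<open>u\<close> removes at least one point at the cost of one degree. In degree 0 the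
  constant 1 shows that a lone coefficient is zero.\<close>

lemma rel_supp_empty:
  assumes "rel k c" "card (supp c) \<le> k + 1"
  shows "supp c = {}"
  using assms
proof (induction k arbitrary: c)
  case 0
  show ?case
  proof (rule ccontr)
    assume "supp c \<noteq> {}"
    then obtain u where "supp c = {u}"
      using 0 by (metis One_nat_def add_0 card_0_eq card_1_singletonE finite_supp le_Suc_eq le_zero_eq)
    then have u: "u \<in> X" "c u \<noteq> 0" "\<And>v. v \<in> X \<Longrightarrow> v \<noteq> u \<Longrightarrow> c v = 0"
      by (auto simp: supp_def)
    then have "(\<Sum>v\<in>X. c v * ev v 1) = (\<Sum>v\<in>X. if v = u then c v else 0)"
      by (intro sum.cong) auto
    then have "(\<Sum>v\<in>X. c v * ev v 1) = c u" using u finite_X by simp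
    then show False using 0 u one_forms by (auto simp: rel_def)
  qed
next
  case (Suc k)
  show ?case
  proof (rule ccontr)
    assume "supp c \<noteq> {}"
    then obtain u where u: "u \<in> supp c" by blast
    obtain L where L: "L \<in> forms 1" "ev u L \<noteq> 0"
      and small: "card (supp (\<lambda>v. c v * ev v L)) \<le> k + 1"
    proof (cases "supp c = {u}")
      case True
      obtain L where "L \<in> forms 1" "ev u L \<noteq> 0"
        using nonvanishing_linear_form u by (auto simp: supp_def)
      moreover have "card (supp (\<lambda>v. c v * ev v L)) \<le> card {u}"
        using True by (intro card_mono) (auto simp: supp_mult)
      ultimately show ?thesis using that by force
    next
      case False
      then obtain w where w: "w \<in> supp c" "w \<noteq> u" using u by blast
      then obtain L where L: "L \<in> forms 1" "ev u L \<noteq> 0" "ev w L = 0"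
        using separating_linear_form[of u w] u by (auto simp: supp_def)
      have "supp (\<lambda>v. c v * ev v L) \<subseteq> supp c - {w}" using L by (auto simp: supp_mult)
      then have "card (supp (\<lambda>v. c v * ev v L)) \<le> card (supp c - {w})"
        by (intro card_mono) auto
      then show ?thesis using that L w Suc.prems by simp
    qed
    have "rel k (\<lambda>v. c v * ev v L)" using rel_mult[of k 1] Suc.prems L by simp
    then have "supp (\<lambda>v. c v * ev v L) = {}" using Suc.IH small by blast
    then show False using u L by (auto simp: supp_mult)
  qed
qed

lemma exists_line:
  fixes S :: "(3 \<Rightarrow> complex) set"
  assumes "finite S" "card S \<le> 2"
  shows "\<exists>L\<in>forms 1. L \<noteq> 0 \<and> (\<forall>v\<in>S. ev v L = 0)"
  by (rule exists_form_vanishing) (use assms card_exponents_1 in simp_all)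

lemma exists_conic:
  fixes S :: "(3 \<Rightarrow> complex) set"
  assumes "finite S" "card S \<le> 5"
  shows "\<exists>Q\<in>forms 2. Q \<noteq> 0 \<and> (\<forall>v\<in>S. ev v Q = 0)"
  by (rule exists_form_vanishing) (use assms card_exponents_2 in simp_all)

text \<open>In degree \<open>Suc k\<close>, let \<open>L\<close> pass through two support points. By
  induction the part off \<open>L\<close> lies on a line \<open>L'\<close>, so the parts off
  \<open>L\<close> and off \<open>L'\<close> are disjoint. If both were nonempty they would have at
  least \<open>2 * (k + 2)\<close> points together, one more than allowed.\<close>

lemma rel_supp_collinear:
  assumes "rel k c" "card (supp c) \<le> 2 * k + 1"
  shows "\<exists>L\<in>forms 1. L \<noteq> 0 \<and> (\<forall>v\<in>supp c. ev v L = 0)"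
  using assms
proof (induction k arbitrary: c)
  case 0
  then show ?case using exists_line[of "supp c"] by simp
next
  case (Suc k)
  show ?case
  proof (cases "card (supp c) \<le> 2")
    case True
    then show ?thesis using exists_line[of "supp c"] by simp
  next
    case False
    then obtain S where S: "S \<subseteq> supp c" "card S = 2"
      using obtain_subset_with_card_n[of 2 "supp c"] by auto
    have "finite S" using S(1) finite_supp by (rule finite_subset)
    then obtain L where L: "L \<in> forms 1" "L \<noteq> 0" "\<And>v. v \<in> S \<Longrightarrow> ev v L = 0"
      using exists_line[OF \<open>finite S\<close> eq_refl[OF S(2)]] by blast
    have rel: "rel k (\<lambda>v. c v * ev v F)" if "F \<in> forms 1" for F
      using rel_mult[of k 1 c F] Suc.prems(1) that by simp
    have "card S \<le> card {v \<in> supp c. ev v L = 0}"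
      using S(1) L(3) by (intro card_mono) (simp, blast)
    then have card: "card (supp (\<lambda>v. c v * ev v L)) \<le> 2 * k + 1"
      using card_supp_mult[of c L] S(2) Suc.prems(2) by simp
    then obtain L' where L': "L' \<in> forms 1" "L' \<noteq> 0" "\<And>v. v \<in> supp (\<lambda>v. c v * ev v L) \<Longrightarrow> ev v L' = 0"
      using Suc.IH[OF rel[OF L(1)] card] by blast
    have disj: "supp (\<lambda>v. c v * ev v L) \<inter> supp (\<lambda>v. c v * ev v L') = {}"
      using L'(3) unfolding supp_mult[of c L'] by blast
    have large: "k + 2 \<le> card (supp (\<lambda>v. c v * ev v F))"
      if "F \<in> forms 1" "supp (\<lambda>v. c v * ev v F) \<noteq> {}" for F
    proof (rule ccontr)
      assume "\<not> ?thesis"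
      then show False using rel_supp_empty[OF rel[OF that(1)]] that(2) by simp
    qed
    consider "supp (\<lambda>v. c v * ev v L) = {}" | "supp (\<lambda>v. c v * ev v L') = {}"
      | "k + 2 \<le> card (supp (\<lambda>v. c v * ev v L))" "k + 2 \<le> card (supp (\<lambda>v. c v * ev v L'))"
      using large[OF L(1)] large[OF L'(1)] by blast
    then show ?thesis
    proof cases
      case 1
      then have "\<forall>v\<in>supp c. ev v L = 0" unfolding supp_mult by blast
      then show ?thesis using L by blast
    next
      case 2
      then have "\<forall>v\<in>supp c. ev v L' = 0" unfolding supp_mult by blast
      then show ?thesis using L' by blast
    next
      case 3
      have "card (supp (\<lambda>v. c v * ev v L) \<union> supp (\<lambda>v. c v * ev v L')) \<le> card (supp c)"
        by (intro card_mono) (auto simp: supp_mult)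
      then show ?thesis
        using 3 Suc.prems(2) card_Un_disjoint[OF finite_supp finite_supp disj] by simp
    qed
  qed
qed

section \<open>Points in general position\<close>

definition no_three_collinear :: "(3 \<Rightarrow> complex) set \<Rightarrow> bool"
  where "no_three_collinear U \<longleftrightarrow> (\<forall>L\<in>forms 1. L \<noteq> 0 \<longrightarrow> card {v \<in> U. ev v L = 0} \<le> 2)"

definition no_six_on_conic :: "(3 \<Rightarrow> complex) set \<Rightarrow> bool"
  where "no_six_on_conic U \<longleftrightarrow> (\<forall>Q\<in>forms 2. Q \<noteq> 0 \<longrightarrow> card {v \<in> U. ev v Q = 0} \<le> 5)"

lemma no_three_collinearD:
  assumes "no_three_collinear U" "finite U" "S \<subseteq> U" "L \<in> forms 1" "L \<noteq> 0" "\<And>v. v \<in> S \<Longrightarrow> ev v L = 0"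
  shows "card S \<le> 2"
proof -
  have "card S \<le> card {v \<in> U. ev v L = 0}" using assms by (intro card_mono) auto
  then show ?thesis using assms by (force simp: no_three_collinear_def)
qed

lemma card_supp_ge:
  assumes "rel k c" "supp c \<subseteq> U" "finite U" "no_three_collinear U" "supp c \<noteq> {}"
  shows "card (supp c) \<ge> 2 * k + 2"
proof (rule ccontr)
  assume less: "\<not> ?thesis"
  then obtain L where "L \<in> forms 1" "L \<noteq> 0" "\<And>v. v \<in> supp c \<Longrightarrow> ev v L = 0"
    using rel_supp_collinear[of k c] assms(1) by auto
  then have "card (supp c) \<le> 2" using no_three_collinearD assms by blast
  \<comment> \<open>For \<open>k = 0\<close> this comes from \<open>less\<close>; for larger
    \<open>k\<close> two points are few enough.\<close>
  then have "card (supp c) \<le> k + 1" using less by auto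
  then show False using rel_supp_empty assms by blast
qed

text \<open>For finite \<open>U\<close>, this says that the relations of degree \<open>k\<close>
  supported in \<open>U\<close> form a space of dimension at most \<open>m\<close>, expressed by
  coordinates \<open>D\<close> that determine every element.\<close>

definition determined :: "nat \<Rightarrow> (3 \<Rightarrow> complex) set \<Rightarrow> nat \<Rightarrow> bool"
  where "determined k U m \<longleftrightarrow> (\<exists>D\<subseteq>U. card D \<le> m \<and>
    (\<forall>c. rel k c \<longrightarrow> supp c \<subseteq> U \<longrightarrow> supp c \<inter> D = {} \<longrightarrow> supp c = {}))"

text \<open>Each additional point raises the dimension by at most one, since its coordinate can be
  added to \<open>D\<close>.\<close>

lemma determined_extend:
  assumes "\<And>U'. U' \<subseteq> U \<Longrightarrow> card U' \<le> p \<Longrightarrow> determined k U' m"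
    and "finite U" "card U \<le> p + s"
  shows "determined k U (m + s)"
proof -
  obtain E where E: "E \<subseteq> U" "card E = min s (card U)"
    using obtain_subset_with_card_n[of "min s (card U)" U] by auto
  then have "card (U - E) \<le> p" using assms(2,3) by (simp add: card_Diff_subset finite_subset)
  then obtain D where D: "D \<subseteq> U - E" "card D \<le> m"
    "\<And>c. rel k c \<Longrightarrow> supp c \<subseteq> U - E \<Longrightarrow> supp c \<inter> D = {} \<Longrightarrow> supp c = {}"
    using assms(1)[of "U - E"] unfolding determined_def by auto
  have "card (D \<union> E) \<le> m + s"
    using card_Un_le[of D E] D(2) E(2) by simp
  moreover have "supp c = {}" if "rel k c" "supp c \<subseteq> U" "supp c \<inter> (D \<union> E) = {}" for c
    using D(3)[of c] that by blast
  moreover have "D \<union> E \<subseteq> U" using D(1) E(1) by blast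
  ultimately show ?thesis unfolding determined_def by (intro exI[of _ "D \<union> E"] conjI allI impI)
qed

lemma general_position_subset:
  assumes "U' \<subseteq> U" "finite U"
  shows "no_three_collinear U \<Longrightarrow> no_three_collinear U'" "no_six_on_conic U \<Longrightarrow> no_six_on_conic U'"
proof -
  have le: "card {v \<in> U'. ev v F = 0} \<le> card {v \<in> U. ev v F = 0}" for F
    using assms by (intro card_mono) auto
  show "no_three_collinear U'" if "no_three_collinear U"
    using that order.trans[OF le] unfolding no_three_collinear_def by simp
  show "no_six_on_conic U'" if "no_six_on_conic U"
    using that order.trans[OF le] unfolding no_six_on_conic_def by simp
qed

lemma determined_1I:
  assumes dep: "\<And>c c' e. rel k c \<Longrightarrow> rel k c' \<Longrightarrow> supp c \<subseteq> U \<Longrightarrow> supp c' \<subseteq> U \<Longrightarrow>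
    e \<in> supp c \<Longrightarrow> c' e = 0 \<Longrightarrow> supp c' = {}"
  shows "determined k U 1"
proof (cases "\<exists>c. rel k c \<and> supp c \<subseteq> U \<and> supp c \<noteq> {}")
  case True
  then obtain c e where c: "rel k c" "supp c \<subseteq> U" "e \<in> supp c" by blast
  have "supp c' = {}" if "rel k c'" "supp c' \<subseteq> U" "supp c' \<inter> {e} = {}" for c'
  proof -
    have "c' e = 0" using c(3) that(3) by (auto simp: supp_def)
    then show ?thesis using dep[of c c' e] c that by blast
  qed
  then show ?thesis using c unfolding determined_def by (intro exI[of _ "{e}"]) auto
next
  case False
  then show ?thesis unfolding determined_def by (intro exI[of _ "{}"]) auto
qed

text \<open>
  If \<open>c\<close>, \<open>c'\<close> were independent relations, the pairs of linear forms with \<open>l c + l' c' = 0\<close> would form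
  a space of dimension at least two, and two independent pairs \<open>(l, l')\<close>, \<open>(m, m')\<close> would produce
  the conic \<open>l m' - l' m = 0\<close> through the supports.
\<close>

lemma determined_general_position:
  assumes "k \<ge> 1" "finite U" "card U \<le> 3 * k + 1" "no_three_collinear U" "no_six_on_conic U"
  shows "determined k U 1"
  using assms
proof (induction k arbitrary: U rule: dec_induct)
  case base
  show ?case
  proof (rule determined_1I)
    fix c c' e
    assume *: "rel 1 c'" "supp c' \<subseteq> U" "supp c \<subseteq> U" "e \<in> supp c" "c' e = 0"
    \<comment> \<open>At most three points remain, while by \<open>card_supp_ge\<close> a nonzero
      relation of degree 1 needs four.\<close>
    then have "supp c' \<subseteq> U - {e}" by (auto simp: supp_def)
    then have "card (supp c') \<le> card (U - {e})" using base by (intro card_mono) auto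
    also have "\<dots> < card U" using * base by (intro card_Diff1_less) auto
    finally show "supp c' = {}" using card_supp_ge[of 1 c' U] * base by force
  qed
next
  case (step k)
  show ?case
  proof (rule determined_1I, rule ccontr)
    fix c c' e
    assume c: "rel (Suc k) c" "rel (Suc k) c'" "supp c \<subseteq> U" "supp c' \<subseteq> U"
      and e: "e \<in> supp c" "c' e = 0" and ne: "supp c' \<noteq> {}"
    have card_c': "card (supp c') \<ge> 6"
      using card_supp_ge[OF c(2,4)] step ne by force
    have sub: "no_three_collinear U'" "no_six_on_conic U'" if "U' \<subseteq> U" for U'
      using general_position_subset[OF that] step.prems by simp_all
    have "determined k U' 1" if "U' \<subseteq> U" "card U' \<le> 3 * k + 1" for U'
      using step.IH[OF _ that(2) sub[OF that(1)]] finite_subset[OF that(1)] step.prems by simp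
    \<comment> \<open>The bound \<open>3 * Suc k + 1\<close> exceeds \<open>3 * k + 1\<close> by
      three, so the dimension in degree \<open>k\<close> is at most four.\<close>
    then have "determined k U (1 + 3)"
      using determined_extend[of U "3 * k + 1" k 1 3] step.prems by simp
    then obtain D where D: "D \<subseteq> U" "card D \<le> 4"
      "\<And>c. rel k c \<Longrightarrow> supp c \<subseteq> U \<Longrightarrow> supp c \<inter> D = {} \<Longrightarrow> supp c = {}"
      unfolding determined_def by auto
    \<comment> \<open>The unknowns are the six coefficients of a pair of linear forms:
      \<open>Inl\<close> for the multiplier of \<open>c\<close>, \<open>Inr\<close> for that of
      \<open>c'\<close>. At most four conditions at \<open>D\<close> leave two independent
      pairs.\<close>
    define M where "M v s = (case s of Inl j \<Rightarrow> c v * v j | Inr j \<Rightarrow> c' v * v j)"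
      for v :: "3 \<Rightarrow> complex" and s :: "3 + 3"
    have Msum: "(\<Sum>s\<in>UNIV. M v s * x s)
        = c v * dot (\<lambda>j. x (Inl j)) v + c' v * dot (\<lambda>j. x (Inr j)) v" for v x
      unfolding UNIV_Plus_UNIV[symmetric]
      unfolding sum.Plus[OF finite finite] dot_def sum_distrib_left
      by (intro arg_cong2[where f = "(+)"] sum.cong refl) (simp_all add: M_def mult_ac)
    \<comment> \<open>The combination is a relation of degree \<open>k\<close> that vanishes on
      \<open>D\<close>, hence everywhere.\<close>
    have zero: "c v * dot (\<lambda>j. x (Inl j)) v + c' v * dot (\<lambda>j. x (Inr j)) v = 0"
      if "\<forall>v\<in>D. (\<Sum>s\<in>UNIV. M v s * x s) = 0" "v \<in> X" for x v
    proof -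
      define h where "h v = 1 * (c v * ev v (linear_form (\<lambda>j. x (Inl j))))
        + 1 * (c' v * ev v (linear_form (\<lambda>j. x (Inr j))))" for v
      have "rel k h" unfolding h_def using c
        by (intro rel_linear_combination rel_mult[of k 1]) (simp_all add: linear_form_forms[unfolded One_nat_def])
      moreover have "supp h \<subseteq> U" using c(3,4) unfolding supp_def h_def by fastforce
      moreover have "h v = (\<Sum>s\<in>UNIV. M v s * x s)" for v
        unfolding Msum h_def by (simp add: ev_linear_form_dot)
      ultimately show ?thesis using D(3)[of h] that by (auto simp: supp_def Msum)
    qed
    have card_D: "card D + 1 < card (UNIV :: (3 + 3) set)"
      using D(2) by (simp flip: UNIV_Plus_UNIV add: card_Plus)
    obtain x y j0 where
      x: "\<forall>v\<in>D. (\<Sum>s\<in>UNIV. M v s * x s) = 0" and y: "\<forall>v\<in>D. (\<Sum>s\<in>UNIV. M v s * y s) = 0"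
      and "j0 \<in> UNIV" and j0: "x j0 \<noteq> 0" "y j0 = 0" and y_ne: "\<exists>j\<in>UNIV. y j \<noteq> 0"
      by (rule two_independent_solutions[OF finite_subset[OF D(1) \<open>finite U\<close>] finite card_D, where M = M])
    define a b a' b' where "a = (\<lambda>j. x (Inl j))" and "b = (\<lambda>j. x (Inr j))"
      and "a' = (\<lambda>j. y (Inl j))" and "b' = (\<lambda>j. y (Inr j))"
    have xx: "c v * dot a v + c' v * dot b v = 0" and yy: "c v * dot a' v + c' v * dot b' v = 0"
      if "v \<in> X" for v
      using zero[OF x that] zero[OF y that] by (simp_all add: a_def b_def a'_def b'_def)
    define Q where "Q = linear_form a * linear_form b' - linear_form b * linear_form a'"
    have evQ: "ev v Q = dot a v * dot b' v - dot b v * dot a' v" for v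
    proof -
      have "ev v Q + ev v (linear_form b * linear_form a') = ev v (linear_form a * linear_form b')"
        unfolding Q_def by (simp flip: extend_add)
      then show ?thesis by (simp add: ev_mult ev_linear_form_dot algebra_simps)
    qed
    have "Q \<in> forms 2"
      unfolding Q_def using forms_mult[of _ 1 _ 1] linear_form_forms
      by (metis cvs.subspace_diff forms_subspace one_add_one)
    moreover have "card {v \<in> U. ev v Q = 0} > 5"
    proof -
      have "ev v Q = 0" if "v \<in> supp c'" for v
      proof -
        have v: "v \<in> X" "c' v \<noteq> 0" using that by (auto simp: supp_def)
        \<comment> \<open>The nonzero vector \<open>(c v, c' v)\<close> solves a 2 by 2 system whose
          determinant is the value of \<open>Q\<close>.\<close>
        then have "c' v * (dot a v * dot b' v - dot b v * dot a' v) = 0"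
          using xx[OF v(1)] yy[OF v(1)] by algebra
        then show ?thesis using v by (simp add: evQ)
      qed
      then have "card (supp c') \<le> card {v \<in> U. ev v Q = 0}"
        using c(4) step.prems by (intro card_mono) auto
      then show ?thesis using card_c' by simp
    qed
    ultimately have "Q = 0" using step.prems by (force simp: no_six_on_conic_def)
    then have eq: "dot a v * dot b' v = dot b v * dot a' v" for v
      using evQ[of v] by simp
    have "a \<noteq> (\<lambda>_. 0)"
    proof
      assume a: "a = (\<lambda>_. 0)"
      have "b \<noteq> (\<lambda>_. 0)"
        using j0(1) a by (cases j0) (auto simp: a_def b_def fun_eq_iff)
      moreover have "ev v (linear_form b) = 0" if "v \<in> supp c'" for v
        using xx[of v] that by (auto simp: a supp_def dot_def ev_linear_form)
      ultimately have "card (supp c') \<le> 2"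
        using no_three_collinearD[of U "supp c'" "linear_form b"] step.prems c linear_form_forms
          linear_form_nonzero by blast
      then show False using card_c' by simp
    qed
    \<comment> \<open>Either \<open>b\<close> is \<open>t\<close> times \<open>a\<close>, and then
      \<open>c + t c'\<close> is a nonzero relation supported on the line of \<open>a\<close>, or
      the second pair is a multiple of the first.\<close>
    from dot_mult_eq[OF eq this] show False
    proof (elim disjE exE conjE)
      fix t
      assume t: "b = (\<lambda>j. t * a j)"
      define h where "h v = 1 * c v + t * c' v" for v
      have "rel (Suc k) h" unfolding h_def using c by (intro rel_linear_combination)
      moreover have sub: "supp h \<subseteq> U" using c(3,4) unfolding supp_def h_def by fastforce
      moreover have "supp h \<noteq> {}" using e by (auto simp: h_def supp_def)
      ultimately have "card (supp h) \<ge> 2 * Suc k + 2"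
        using card_supp_ge[of "Suc k" h U] step.prems by blast
      moreover have "ev v (linear_form a) = 0" if "v \<in> supp h" for v
      proof -
        have "dot b v = t * dot a v" by (simp add: t dot_def sum_distrib_left mult_ac)
        then have "h v * dot a v = 0" using xx[of v] that by (simp add: h_def supp_def algebra_simps)
        then show ?thesis using that by (simp add: supp_def ev_linear_form_dot)
      qed
      then have "card (supp h) \<le> 2"
        using no_three_collinearD[of U "supp h" "linear_form a"] step.prems sub linear_form_forms
          linear_form_nonzero[OF \<open>a \<noteq> _\<close>] by blast
      ultimately show False by simp
    next
      fix t
      assume t: "a' = (\<lambda>j. t * a j)" "b' = (\<lambda>j. t * b j)"
      have yx: "y j = t * x j" for j
        using fun_cong[OF t(1)] fun_cong[OF t(2)] by (cases j) (auto simp: a_def b_def a'_def b'_def)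
      then have "t = 0" using j0 by simp
      then show False using yx y_ne by simp
    qed
  qed
qed

section \<open>Relations with fewer than \<open>3 * d\<close> points\<close>

lemma supp_subset_if_mult_empty:
  "supp (\<lambda>v. c v * ev v F) = {} \<Longrightarrow> v \<in> supp c \<Longrightarrow> ev v F = 0"
  unfolding supp_mult by blast

text \<open>Strong induction on \<open>d\<close>. If a line carries three support points or a conic
  carries six, multiplying by it removes enough points for the induction hypothesis. Otherwise the
  support is in general position and \<open>determined_general_position\<close> applies.\<close>

lemma rel_supp_conic:
  assumes "rel d c" "card (supp c) < 3 * d"
  shows "\<exists>Q\<in>forms 2. Q \<noteq> 0 \<and> (\<forall>v\<in>supp c. ev v Q = 0)"
  using assms
proof (induction d arbitrary: c rule: less_induct)
  case (less d)
  let ?m = "\<lambda>F v. c v * ev v F"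
  have conicI: ?case if "Q \<in> forms 2" "Q \<noteq> 0" "supp (?m Q) = {}" for Q
    using that supp_subset_if_mult_empty by blast
  show ?case
  proof (cases "card (supp c) \<le> 5")
    case True
    then show ?thesis by (rule exists_conic[OF finite_supp])
  next
    case False
    \<comment> \<open>Six points below the bound \<open>3 * d\<close> exclude smaller degrees, so
      \<open>d - 2\<close> is positive.\<close>
    then have d: "d \<ge> 3" using less.prems by simp
    then have "d - 1 < d" "d - 2 < d" by simp_all
    have eq: "d - 1 + 1 = d" "d - 2 + 2 = d" using d by simp_all
    have rel1: "rel (d - 1) (?m L)" if "L \<in> forms 1" for L
      using rel_mult[of "d - 1" 1 c L] that less.prems(1) unfolding eq by blast
    have rel2: "rel (d - 2) (?m Q)" if "Q \<in> forms 2" for Q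
      using rel_mult[of "d - 2" 2 c Q] that less.prems(1) unfolding eq by blast
    show ?thesis
    proof (cases "no_three_collinear (supp c)")
      case not_general: False
      then obtain L where L: "L \<in> forms 1" "L \<noteq> 0" and "\<not> card {v \<in> supp c. ev v L = 0} \<le> 2"
        unfolding no_three_collinear_def by blast
      then have line: "card {v \<in> supp c. ev v L = 0} \<ge> 3" by simp
      have card: "card (supp (?m L)) + card {v \<in> supp c. ev v L = 0} = card (supp c)"
        using card_supp_mult[of c L] by simp
      then have "card (supp (?m L)) < 3 * (d - 1)" using line less.prems(2) by simp
      then obtain Q where Q: "Q \<in> forms 2" "Q \<noteq> 0" "\<And>v. v \<in> supp (?m L) \<Longrightarrow> ev v Q = 0"
        using less.IH[OF \<open>d - 1 < d\<close> rel1[OF L(1)]] by blast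
      \<comment> \<open>A small residual support is collinear, which gives a pair of lines.
        Otherwise at least \<open>2 * d\<close> points lie off \<open>L\<close>, so at most
        \<open>d - 1\<close> lie on it, too few to support a nonzero relation of degree
        \<open>d - 2\<close>; hence multiplying by \<open>Q\<close> gives zero.\<close>
      show ?thesis
      proof (cases "card (supp (?m L)) \<le> 2 * (d - 1) + 1")
        case True
        then obtain L' where L': "L' \<in> forms 1" "L' \<noteq> 0" "\<And>v. v \<in> supp (?m L) \<Longrightarrow> ev v L' = 0"
          using rel_supp_collinear[OF rel1[OF L(1)]] by blast
        have "L * L' \<in> forms 2" using forms_mult[OF L(1) L'(1)] by (simp only: one_add_one)
        moreover have "L * L' \<noteq> 0" using L L' by simp
        moreover have "ev v (L * L') = 0" if "v \<in> supp c" for v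
        proof (cases "ev v L = 0")
          case False
          then have "v \<in> supp (?m L)" using that unfolding supp_mult by blast
          then show ?thesis using L'(3) by (simp add: ev_mult)
        qed (simp add: ev_mult)
        ultimately show ?thesis by blast
      next
        case False
        have "supp (?m Q) \<subseteq> {v \<in> supp c. ev v L = 0}"
          using Q(3) unfolding supp_mult by blast
        then have "card (supp (?m Q)) \<le> card {v \<in> supp c. ev v L = 0}"
          by (intro card_mono) auto
        then have "card (supp (?m Q)) \<le> (d - 2) + 1"
          using False card less.prems(2) d by simp
        then show ?thesis using conicI[OF Q(1,2)] rel_supp_empty[OF rel2[OF Q(1)]] by blast
      qed
    next
      case general: True
      have large: "supp (?m Q) = {} \<or> card (supp (?m Q)) \<ge> 2 * (d - 2) + 2" if "Q \<in> forms 2" for Q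
      proof -
        have "supp (?m Q) \<subseteq> supp c" unfolding supp_mult by blast
        from card_supp_ge[OF rel2[OF that] this finite_supp general] show ?thesis by blast
      qed
      show ?thesis
      proof (cases "no_six_on_conic (supp c)")
        case False
        then obtain Q where Q: "Q \<in> forms 2" "Q \<noteq> 0" and "\<not> card {v \<in> supp c. ev v Q = 0} \<le> 5"
          unfolding no_six_on_conic_def by blast
        then have conic: "card {v \<in> supp c. ev v Q = 0} \<ge> 6" by simp
        have card: "card (supp (?m Q)) + card {v \<in> supp c. ev v Q = 0} = card (supp c)"
          using card_supp_mult[of c Q] by simp
        then have "card (supp (?m Q)) < 3 * (d - 2)" using conic less.prems(2) by simp
        then obtain Q' where Q': "Q' \<in> forms 2" "Q' \<noteq> 0" "\<And>v. v \<in> supp (?m Q) \<Longrightarrow> ev v Q' = 0"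
          using less.IH[OF \<open>d - 2 < d\<close> rel2[OF Q(1)]] by blast
        show ?thesis
        proof (cases "supp (?m Q) = {}")
          case True
          then show ?thesis using conicI Q by blast
        next
          case False
          then have *: "card (supp (?m Q)) \<ge> 2 * (d - 2) + 2" using large Q by blast
          have "supp (?m Q') \<subseteq> {v \<in> supp c. ev v Q = 0}"
            using Q'(3) unfolding supp_mult by blast
          then have "card (supp (?m Q')) \<le> card {v \<in> supp c. ev v Q = 0}"
            by (intro card_mono) auto
          \<comment> \<open>At least \<open>2 * d - 2\<close> points lie off \<open>Q\<close>, so at
            most \<open>d + 1\<close> lie on it. Since at least six do, \<open>d \<ge> 5\<close> and
            \<open>d + 1 < 2 * d - 2\<close>.\<close>
          then have "\<not> card (supp (?m Q')) \<ge> 2 * (d - 2) + 2"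
            using * card conic less.prems(2) d by simp
          then show ?thesis using conicI[OF Q'(1,2)] large Q' by blast
        qed
      next
        case no_six: True
        have sub: "no_three_collinear U" "no_six_on_conic U" if "U \<subseteq> supp c" for U
          using that general no_six general_position_subset by auto
        have "determined (d - 2) U 1" if "U \<subseteq> supp c" "card U \<le> 3 * (d - 2) + 1" for U
          using determined_general_position[of "d - 2" U] that sub[OF that(1)] d
            finite_subset[OF that(1)] by simp
        \<comment> \<open>Here \<open>3 * d - 1 = (3 * (d - 2) + 1) + 4\<close>, so five coordinates
          suffice, and a conic can be passed through any five points.\<close>
        then have "determined (d - 2) (supp c) (1 + 4)"
          using determined_extend[of "supp c" "3 * (d - 2) + 1" "d - 2" 1 4] less.prems(2) d by simp
        then obtain D where D: "D \<subseteq> supp c" "card D \<le> 5"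
          "\<And>c'. rel (d - 2) c' \<Longrightarrow> supp c' \<subseteq> supp c \<Longrightarrow> supp c' \<inter> D = {} \<Longrightarrow> supp c' = {}"
          unfolding determined_def by auto
        obtain Q where Q: "Q \<in> forms 2" "Q \<noteq> 0" "\<And>v. v \<in> D \<Longrightarrow> ev v Q = 0"
          using exists_conic[OF finite_subset[OF D(1) finite_supp] D(2)] by blast
        have "supp (?m Q) \<inter> D = {}" "supp (?m Q) \<subseteq> supp c" using Q(3) unfolding supp_mult by auto
        then show ?thesis using conicI[OF Q(1,2)] D(3)[OF rel2[OF Q(1)]] by blast
      qed
    qed
  qed
qed

end

section \<open>Apolarity and the Terracini space\<close>

definition exp_fact :: "('n::finite \<Rightarrow>\<^sub>0 nat) \<Rightarrow> complex"
  where "exp_fact e = (\<Prod>j\<in>UNIV. fact (Poly_Mapping.lookup e j))"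

text \<open>The apolarity pairing: multiplication by \<open>x\<^sub>j\<close> is adjoint to \<open>\<partial>/\<partial>x\<^sub>j\<close>.\<close>

definition pairing :: "('n::finite) cpoly \<Rightarrow> 'n cpoly \<Rightarrow> complex"
  where "pairing F G = extend (\<lambda>e. exp_fact e * Poly_Mapping.lookup G e) F"

lemma extend_fun_add: "extend (\<lambda>e. g e + h e) F = extend g F + extend h F"
  by (simp add: extend_def distrib_left sum.distrib)

lemma pairing_zero_right [simp]: "pairing F 0 = 0"
  by (simp add: pairing_def extend_def)

lemma pairing_add_right: "pairing F (G + G') = pairing F G + pairing F G'"
  by (simp add: pairing_def lookup_add distrib_left extend_fun_add)

lemma pairing_cscale_right: "pairing F (cscale a G) = a * pairing F G"
  by (simp add: pairing_def extend_def sum_distrib_left mult_ac)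

lemma pairing_sum_right: "pairing F (\<Sum>i\<in>I. G i) = (\<Sum>i\<in>I. pairing F (G i))"
  by (induction I rule: infinite_finite_induct) (auto simp: pairing_add_right)

lemma exp_fact_nonzero: "exp_fact e \<noteq> 0"
  by (simp add: exp_fact_def)

lemma lookup_var_mult:
  "Poly_Mapping.lookup (var j * G) e =
    (if Poly_Mapping.lookup e j = 0 then 0 else Poly_Mapping.lookup G (e - Poly_Mapping.single j 1))"
proof -
  \<comment> \<open>A coefficient is the extension of an indicator function, so
    \<open>extend_mult\<close> applies.\<close>
  have "Poly_Mapping.lookup (var j * G) e = extend (\<lambda>f. if f = e then 1 else 0) (var j * G)"
    by (simp add: extend_def in_keys_iff if_distrib[of "\<lambda>x. _ * x"] cong: if_cong)
  also have "\<dots> = (\<Sum>f\<in>Poly_Mapping.keys G. Poly_Mapping.lookup G f * (if Poly_Mapping.single j 1 + f = e then 1 else 0))"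
    unfolding extend_mult var_def by simp
  also have "\<dots> = (\<Sum>f\<in>Poly_Mapping.keys G. if f = e - Poly_Mapping.single j 1 then
      (if Poly_Mapping.lookup e j = 0 then 0 else Poly_Mapping.lookup G (e - Poly_Mapping.single j 1)) else 0)"
  proof (intro sum.cong refl)
    fix f
    have "Poly_Mapping.single j 1 + f = e \<longleftrightarrow> Poly_Mapping.lookup e j \<noteq> 0 \<and> f = e - Poly_Mapping.single j 1"
      using monomial_split[of e j] by (auto simp: lookup_add add.commute)
    then show "Poly_Mapping.lookup G f * (if Poly_Mapping.single j 1 + f = e then 1 else 0) =
      (if f = e - Poly_Mapping.single j 1 then
      (if Poly_Mapping.lookup e j = 0 then 0 else Poly_Mapping.lookup G (e - Poly_Mapping.single j 1)) else 0)"
      by auto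
  qed
  also have "\<dots> = (if Poly_Mapping.lookup e j = 0 then 0 else Poly_Mapping.lookup G (e - Poly_Mapping.single j 1))"
    by (simp add: in_keys_iff)
  finally show ?thesis .
qed

lemma exp_fact_remove:
  assumes "Poly_Mapping.lookup e j \<noteq> 0"
  shows "exp_fact e = of_nat (Poly_Mapping.lookup e j) * exp_fact (e - Poly_Mapping.single j 1)"
proof -
  have "exp_fact e = fact (Poly_Mapping.lookup e j) * (\<Prod>i\<in>UNIV - {j}. fact (Poly_Mapping.lookup e i))"
    unfolding exp_fact_def by (rule prod.remove) auto
  moreover have "exp_fact (e - Poly_Mapping.single j 1) = fact (Poly_Mapping.lookup e j - 1)
      * (\<Prod>i\<in>UNIV - {j}. fact (Poly_Mapping.lookup e i))"
    unfolding exp_fact_def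
    by (subst prod.remove[of UNIV j]) (auto simp: lookup_minus lookup_single when_def intro!: prod.cong)
  ultimately show ?thesis
    using fact_reduce[of "Poly_Mapping.lookup e j", where 'a = complex] assms by simp
qed

text \<open>Adjointness of multiplication by a linear form and differentiation along
  \<open>t\<close>, coefficient by coefficient: lowering an exponent takes one factor out of the
  factorial weight.\<close>

lemma exp_fact_lookup_linear_form_mult:
  "exp_fact e * Poly_Mapping.lookup (linear_form t * G) e =
    (\<Sum>j\<in>UNIV. t j * of_nat (Poly_Mapping.lookup e j) *
      (exp_fact (e - Poly_Mapping.single j 1) * Poly_Mapping.lookup G (e - Poly_Mapping.single j 1)))"
proof -
  have "linear_form t * G = (\<Sum>j\<in>UNIV. cscale (t j) (var j * G))"
    by (simp add: linear_form_def sum_distrib_right cscale_def mult.assoc)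
  then show ?thesis
    by (auto simp: lookup_sum sum_distrib_left lookup_var_mult exp_fact_remove intro!: sum.cong)
qed

lemma exponents_remove:
  assumes "e \<in> exponents (Suc d)" "Poly_Mapping.lookup e j \<noteq> 0"
  shows "e - Poly_Mapping.single j 1 \<in> exponents d"
proof -
  define f where "f = e - Poly_Mapping.single j 1"
  have "e = f + Poly_Mapping.single j 1"
    using monomial_split[of e j] assms(2) by (simp add: f_def)
  then have "(\<Sum>i\<in>UNIV. Poly_Mapping.lookup e i)
      = (\<Sum>i\<in>UNIV. Poly_Mapping.lookup f i) + (\<Sum>i\<in>UNIV. if i = j then 1 else 0)"
    unfolding sum.distrib[symmetric] by (intro sum.cong) (auto simp: lookup_add lookup_single when_def)
  then show ?thesis using assms(1) by (simp add: exponents_def f_def)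
qed

lemma euler_mon:
  assumes "e \<in> exponents d"
  shows "dmon v v e = of_nat d * mon v e"
proof -
  have "v j * of_nat (Poly_Mapping.lookup e j) * mon v (e - Poly_Mapping.single j 1)
      = of_nat (Poly_Mapping.lookup e j) * mon v e" for j
  proof (cases "Poly_Mapping.lookup e j = 0")
    case False
    then have "mon v e = mon v (e - Poly_Mapping.single j 1) * v j"
      using monomial_split[of e j] by (metis mon_add mon_single power_one_right bot_nat_0.not_eq_extremum)
    then show ?thesis by simp
  qed simp
  then have "dmon v v e = of_nat (\<Sum>j\<in>UNIV. Poly_Mapping.lookup e j) * mon v e"
    unfolding dmon_def by (simp only: sum_distrib_right of_nat_sum)
  moreover have "(\<Sum>j\<in>UNIV. Poly_Mapping.lookup e j) = d" using assms by (simp add: exponents_def)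
  ultimately show ?thesis by (simp only:)
qed

text \<open>The multinomial theorem with factorial weights. In the induction step the sum is the
  derivative of the monomial at \<open>v\<close> along \<open>v\<close> itself, which Euler's
  identity evaluates.\<close>

lemma exp_fact_lookup_power:
  "e \<in> exponents d \<Longrightarrow> exp_fact e * Poly_Mapping.lookup (linear_form v ^ d) e = fact d * mon v e"
proof (induction d arbitrary: e)
  case 0
  then have "e = 0" by (intro poly_mapping_eqI) (simp add: exponents_def)
  then show ?case by (simp add: exp_fact_def)
next
  case (Suc d)
  have "exp_fact e * Poly_Mapping.lookup (linear_form v ^ Suc d) e = fact d * dmon v v e"
    unfolding power_Suc exp_fact_lookup_linear_form_mult dmon_def sum_distrib_left
  proof (intro sum.cong refl)
    fix j
    show "v j * of_nat (Poly_Mapping.lookup e j) * (exp_fact (e - Poly_Mapping.single j 1) *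
        Poly_Mapping.lookup (linear_form v ^ d) (e - Poly_Mapping.single j 1)) =
      fact d * (v j * of_nat (Poly_Mapping.lookup e j) * mon v (e - Poly_Mapping.single j 1))"
      using Suc.IH[OF exponents_remove[OF Suc.prems, of j]]
      by (cases "Poly_Mapping.lookup e j = 0") auto
  qed
  then show ?case using euler_mon[OF Suc.prems, of v] by simp
qed

lemma pairing_eq_extend:
  assumes "F \<in> forms d" "\<And>e. e \<in> exponents d \<Longrightarrow> exp_fact e * Poly_Mapping.lookup G e = a * g e"
  shows "pairing F G = a * extend g F"
proof -
  have "Poly_Mapping.lookup F e * (exp_fact e * Poly_Mapping.lookup G e) = a * (Poly_Mapping.lookup F e * g e)"
    if "e \<in> Poly_Mapping.keys F" for e
  proof -
    have "e \<in> exponents d" using that assms(1) by (auto simp: forms_iff)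
    from assms(2)[OF this] show ?thesis by simp
  qed
  then show ?thesis unfolding pairing_def extend_def sum_distrib_left by (rule sum.cong[OF refl])
qed

text \<open>This turns dependencies among powers of linear forms into relations among
  values.\<close>

lemma pairing_power: "F \<in> forms d \<Longrightarrow> pairing F (linear_form v ^ d) = fact d * ev v F"
  by (rule pairing_eq_extend) (auto simp: exp_fact_lookup_power)

lemma pairing_tangent:
  assumes "F \<in> forms (Suc d)"
  shows "pairing F (linear_form t * linear_form v ^ d) = fact d * extend (dmon t v) F"
  using assms
proof (rule pairing_eq_extend)
  fix e :: "'a \<Rightarrow>\<^sub>0 nat"
  assume e: "e \<in> exponents (Suc d)"
  show "exp_fact e * Poly_Mapping.lookup (linear_form t * linear_form v ^ d) e = fact d * dmon t v e"
    unfolding exp_fact_lookup_linear_form_mult dmon_def sum_distrib_left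
  proof (intro sum.cong refl)
    fix j
    show "t j * of_nat (Poly_Mapping.lookup e j) * (exp_fact (e - Poly_Mapping.single j 1) *
        Poly_Mapping.lookup (linear_form v ^ d) (e - Poly_Mapping.single j 1)) =
      fact d * (t j * of_nat (Poly_Mapping.lookup e j) * mon v (e - Poly_Mapping.single j 1))"
      using exp_fact_lookup_power[OF exponents_remove[OF e, of j]]
      by (cases "Poly_Mapping.lookup e j = 0") auto
  qed
qed

section \<open>Tangent directions and the Terracini bound\<close>

lemma deriv_linear:
  "extend (dmon t v) F
    = (\<Sum>j\<in>UNIV. extend (\<lambda>e. of_nat (Poly_Mapping.lookup e j) * mon v (e - Poly_Mapping.single j 1)) F * t j)"
  unfolding extend_def dmon_def sum_distrib_left sum_distrib_right
  by (subst sum.swap) (intro sum.cong refl, simp add: mult_ac)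

lemma deriv_euler:
  assumes "F \<in> forms m"
  shows "extend (dmon v v) F = of_nat m * ev v F"
  unfolding extend_def sum_distrib_left
proof (intro sum.cong refl)
  fix e
  assume "e \<in> Poly_Mapping.keys F"
  then have "e \<in> exponents m" using assms by (auto simp: forms_iff)
  then show "Poly_Mapping.lookup F e * dmon v v e = of_nat m * (Poly_Mapping.lookup F e * mon v e)"
    by (simp add: euler_mon)
qed

text \<open>The derivative condition and \<open>t i = 0\<close>, for an \<open>i\<close> with
  \<open>v i \<noteq> 0\<close>, are two linear conditions on three unknowns; the second makes a
  nonzero \<open>t\<close> independent of \<open>v\<close>.\<close>

lemma exists_tangent_direction:
  fixes v :: "3 \<Rightarrow> complex"
  assumes "v \<noteq> (\<lambda>_. 0)"
  shows "\<exists>t. extend (dmon t v) F = 0 \<and>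
    (\<forall>a b. (\<lambda>j. a * v j + b * t j) = (\<lambda>_. 0) \<longrightarrow> a = 0 \<and> b = 0)"
proof -
  obtain i where i: "v i \<noteq> 0" using assms by auto
  define g where "g j = extend (\<lambda>e. of_nat (Poly_Mapping.lookup e j) * mon v (e - Poly_Mapping.single j 1)) F" for j
  define M where "M p j = (if p then g j else if j = i then 1 else 0)" for p j
  have "card (UNIV :: bool set) < card (UNIV :: 3 set)" by simp
  then obtain t where t: "\<exists>j\<in>UNIV. t j \<noteq> 0" "\<forall>p\<in>UNIV. (\<Sum>j\<in>UNIV. M p j * t j) = 0"
    using homogeneous_system_nontrivial_solution[of "UNIV :: bool set" "UNIV :: 3 set" M] by auto
  have "(\<Sum>j\<in>UNIV. M True j * t j) = 0" using t(2) by blast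
  then have "extend (dmon t v) F = 0" unfolding deriv_linear by (simp add: M_def g_def)
  moreover have "(\<Sum>j\<in>UNIV. M False j * t j) = (\<Sum>j\<in>UNIV. if j = i then t j else 0)"
    by (intro sum.cong) (auto simp: M_def)
  then have "t i = 0" using t(2) by simp
  moreover have "a = 0 \<and> b = 0" if *: "(\<lambda>j. a * v j + b * t j) = (\<lambda>_. 0)" for a b
  proof -
    have "a = 0" using fun_cong[OF *, of i] \<open>t i = 0\<close> i by simp
    moreover obtain j where "t j \<noteq> 0" using t(1) by blast
    ultimately show ?thesis using fun_cong[OF *, of j] by simp
  qed
  ultimately show ?thesis by blast
qed

lemma linear_form_add: "linear_form (\<lambda>j. a j + b j) = linear_form a + linear_form b"
  by (simp add: linear_form_def cvs.scale_left_distrib sum.distrib)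

lemma linear_form_scale: "linear_form (\<lambda>j. c * a j) = cscale c (linear_form a)"
  by (simp add: linear_form_def cvs.scale_sum_right)

lemma cscale_mult_left: "cscale c F * G = cscale c (F * G)"
  by (simp add: cscale_def mult.assoc)

lemma cscale_mult_right: "F * cscale c G = cscale c (F * G)"
  by (simp add: cscale_def mult_ac)

lemma cscale_power: "cscale c F ^ k = cscale (c ^ k) (F ^ k)"
  by (induction k) (simp_all add: cscale_mult_left cscale_mult_right)

text \<open>
  A relation \<open>\<Sum> (a L\<^sub>v + b L\<^sub>t) L\<^sub>v\<^bsup>d-1\<^esup>\<close> with \<open>t\<close> tangent to the curve \<open>q = 0\<close> at \<open>v\<close> is apolar to all multiples
  of \<open>q\<close>. If there were too many points, such a combination would also be the complex conjugate of
  some \<open>q G\<close>, so \<open>q G\<close> would be orthogonal to itself for a positive definite Hermitian form.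
\<close>

lemma terracini_bound:
  fixes X :: "(3 \<Rightarrow> complex) set"
  assumes "finite X" and nonzero: "\<And>v. v \<in> X \<Longrightarrow> v \<noteq> (\<lambda>_. 0)"
    and indep: "\<And>s v. (\<Sum>v\<in>X. linear_form (s v) * linear_form v ^ k) = 0 \<Longrightarrow> v \<in> X \<Longrightarrow> s v = (\<lambda>_. 0)"
    and q: "q \<in> forms m" "q \<noteq> 0" and "p + m = Suc k"
  shows "2 * card {v \<in> X. ev v q = 0} + card (exponents p :: (3 \<Rightarrow>\<^sub>0 nat) set)
    \<le> card (exponents (Suc k) :: (3 \<Rightarrow>\<^sub>0 nat) set)"
proof (rule ccontr)
  assume large: "\<not> ?thesis"
  define Y where "Y = {v \<in> X. ev v q = 0}"
  have Y: "finite Y" "Y \<subseteq> X" using assms(1) by (auto simp: Y_def)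
  have "\<forall>v\<in>Y. \<exists>t. extend (dmon t v) q = 0 \<and>
    (\<forall>a b. (\<lambda>j. a * v j + b * t j) = (\<lambda>_. 0) \<longrightarrow> a = 0 \<and> b = 0)"
    using exists_tangent_direction nonzero Y(2) by blast
  then obtain t where t: "\<And>v. v \<in> Y \<Longrightarrow> extend (dmon (t v) v) q = 0"
    "\<And>v a b. v \<in> Y \<Longrightarrow> (\<lambda>j. a * v j + b * t v j) = (\<lambda>_. 0) \<Longrightarrow> a = 0 \<and> b = 0"
    by metis
  define N :: "(3 \<Rightarrow>\<^sub>0 nat) set" where "N = exponents p"
  define w where "w v \<beta> = linear_form (if \<beta> then t v else v) * linear_form v ^ k" for v \<beta>
  \<comment> \<open>The system says that \<open>y\<close> is the conjugate of \<open>q * H\<close>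
    in degree \<open>Suc k\<close>. Conjugating the products keeps it linear in \<open>x\<close>,
    which is why \<open>H\<close> has conjugated coefficients.\<close>
  define M where "M e i = (case i of Inl (v, \<beta>) \<Rightarrow> Poly_Mapping.lookup (w v \<beta>) e
    | Inr f \<Rightarrow> - cnj (Poly_Mapping.lookup (q * Poly_Mapping.single f 1) e))" for e i
  have N: "finite N" unfolding N_def by (rule finite_exponents)
  have "card (exponents (Suc k) :: (3 \<Rightarrow>\<^sub>0 nat) set) < card ((Y \<times> (UNIV :: bool set)) <+> N)"
    using large Y(1) N by (simp add: card_Plus card_cartesian_product Y_def N_def)
  then obtain x where x: "\<exists>i\<in>(Y \<times> UNIV) <+> N. x i \<noteq> 0"
    "\<forall>e\<in>exponents (Suc k). (\<Sum>i\<in>(Y \<times> UNIV) <+> N. M e i * x i) = 0"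
    using homogeneous_system_nontrivial_solution[OF finite_exponents, of "(Y \<times> UNIV) <+> N" "Suc k" M] Y(1) N
    by auto
  define s where "s v = (\<lambda>j. x (Inl (v, False)) * v j + x (Inl (v, True)) * t v j)" for v
  define y where "y = (\<Sum>v\<in>Y. linear_form (s v) * linear_form v ^ k)"
  define H where "H = (\<Sum>f\<in>N. Poly_Mapping.single f (cnj (x (Inr f))))"
  have split: "linear_form (s v) * linear_form v ^ k
      = cscale (x (Inl (v, False))) (w v False) + cscale (x (Inl (v, True))) (w v True)" for v
    by (simp add: s_def linear_form_add linear_form_scale distrib_right cscale_mult_left w_def)
  have H: "H \<in> forms p" unfolding H_def N_def by (intro forms_sum single_forms)
  then have qH: "q * H \<in> forms (Suc k)" using forms_mult[OF q(1) H] assms(6) by (simp add: add.commute)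
  have "q * H = (\<Sum>f\<in>N. cscale (cnj (x (Inr f))) (q * Poly_Mapping.single f 1))"
    by (simp add: H_def sum_distrib_left flip: cscale_mult_right)
  then have cnj_qH: "cnj (Poly_Mapping.lookup (q * H) e)
      = (\<Sum>f\<in>N. x (Inr f) * cnj (Poly_Mapping.lookup (q * Poly_Mapping.single f 1) e))" for e
    by (simp add: lookup_sum)
  have y_eq: "Poly_Mapping.lookup y e = cnj (Poly_Mapping.lookup (q * H) e)" if "e \<in> exponents (Suc k)" for e
  proof -
    have "0 = (\<Sum>i\<in>(Y \<times> UNIV) <+> N. M e i * x i)" using x(2) that by simp
    also have "\<dots> = (\<Sum>i\<in>Y \<times> UNIV. M e (Inl i) * x (Inl i)) + (\<Sum>f\<in>N. M e (Inr f) * x (Inr f))"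
      using Y(1) N by (subst sum.Plus) (auto simp: o_def)
    also have "(\<Sum>f\<in>N. M e (Inr f) * x (Inr f)) = - cnj (Poly_Mapping.lookup (q * H) e)"
      unfolding cnj_qH by (simp add: M_def mult.commute flip: sum_negf)
    also have "(\<Sum>i\<in>Y \<times> UNIV. M e (Inl i) * x (Inl i)) = Poly_Mapping.lookup y e"
      unfolding y_def lookup_sum split sum.cartesian_product'
      by (intro sum.cong refl) (simp add: UNIV_bool M_def lookup_add mult.commute)
    finally show ?thesis by simp
  qed
  \<comment> \<open>The squared norm of \<open>q * H\<close> for the Hermitian form with factorial
    weights.\<close>
  define R where "R = (\<Sum>e\<in>Poly_Mapping.keys (q * H).
    (\<Prod>j\<in>UNIV. fact (Poly_Mapping.lookup e j)) * (cmod (Poly_Mapping.lookup (q * H) e))\<^sup>2)"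
  \<comment> \<open>At each \<open>v\<close> in \<open>Y\<close> the derivatives of
    \<open>q * H\<close> along \<open>v\<close> and \<open>t v\<close> vanish: the first by Euler's
    identity for \<open>q\<close>, the second by the choice of \<open>t\<close>.\<close>
  have "pairing (q * H) y = 0"
  proof -
    have "pairing (q * H) (w v \<beta>) = 0" if "v \<in> Y" for v \<beta>
    proof -
      have "ev v q = 0" using that by (simp add: Y_def)
      then show ?thesis
        using t(1)[OF that] deriv_euler[OF q(1), of v]
        by (simp add: w_def pairing_tangent[OF qH] deriv_mult)
    qed
    then show ?thesis
      unfolding y_def pairing_sum_right split by (simp add: pairing_add_right pairing_cscale_right)
  qed
  moreover have "pairing (q * H) y = of_real R"
    unfolding R_def pairing_def extend_def of_real_sum
  proof (intro sum.cong refl)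
    fix e
    assume "e \<in> Poly_Mapping.keys (q * H)"
    then have "e \<in> exponents (Suc k)" using qH by (auto simp: forms_iff)
    then have "Poly_Mapping.lookup (q * H) e * (exp_fact e * Poly_Mapping.lookup y e)
      = exp_fact e * (Poly_Mapping.lookup (q * H) e * cnj (Poly_Mapping.lookup (q * H) e))"
      by (simp add: y_eq)
    also have "\<dots> = of_real ((\<Prod>j\<in>UNIV. fact (Poly_Mapping.lookup e j)) * (cmod (Poly_Mapping.lookup (q * H) e))\<^sup>2)"
      by (simp add: exp_fact_def complex_norm_square[symmetric])
    finally show "Poly_Mapping.lookup (q * H) e * (exp_fact e * Poly_Mapping.lookup y e)
      = of_real ((\<Prod>j\<in>UNIV. fact (Poly_Mapping.lookup e j)) * (cmod (Poly_Mapping.lookup (q * H) e))\<^sup>2)" .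
  qed
  ultimately have "R = 0" by simp
  have "q * H = 0"
  proof (rule ccontr)
    assume "q * H \<noteq> 0"
    then have "Poly_Mapping.keys (q * H) \<noteq> {}" by simp
    then have "R > 0" unfolding R_def
      by (intro sum_pos mult_pos_pos prod_pos) (auto simp: in_keys_iff)
    then show False using \<open>R = 0\<close> by simp
  qed
  then have "H = 0" using q(2) by simp
  have xr: "x (Inr f) = 0" if "f \<in> N" for f
  proof -
    have "Poly_Mapping.lookup H f = (\<Sum>g\<in>N. if g = f then cnj (x (Inr g)) else 0)"
      unfolding H_def lookup_sum by (intro sum.cong) (auto simp: lookup_single when_def)
    then show ?thesis using \<open>H = 0\<close> that N by simp
  qed
  have "y = 0"
  proof (rule poly_mapping_eqI)
    fix e
    have "y \<in> forms (Suc k)" unfolding y_def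
      using forms_mult[OF linear_form_forms power_forms[OF linear_form_forms]] by (intro forms_sum) simp
    then show "Poly_Mapping.lookup y e = Poly_Mapping.lookup 0 e"
      using y_eq[of e] \<open>H = 0\<close> by (cases "e \<in> exponents (Suc k)") (auto simp: forms_iff in_keys_iff)
  qed
  \<comment> \<open>Extension by zero from \<open>Y\<close> to \<open>X\<close> gives the form that
    \<open>indep\<close> requires.\<close>
  moreover have "y = (\<Sum>v\<in>X. linear_form (if v \<in> Y then s v else (\<lambda>_. 0)) * linear_form v ^ k)"
    unfolding y_def using Y assms(1)
    by (intro sum.mono_neutral_cong_left) (auto simp: linear_form_def)
  ultimately have "s v = (\<lambda>_. 0)" if "v \<in> Y" for v
    using indep[of "\<lambda>v. if v \<in> Y then s v else (\<lambda>_. 0)" v] that Y(2) by auto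
  then have "x (Inl (v, False)) = 0 \<and> x (Inl (v, True)) = 0" if "v \<in> Y" for v
    using t(2)[OF that, of "x (Inl (v, False))" "x (Inl (v, True))"] that unfolding s_def by blast
  then have "x (Inl (v, \<beta>)) = 0" if "v \<in> Y" for v \<beta>
    using that by (cases \<beta>) auto
  then show False using x(1) xr by auto
qed

context point_set
begin

text \<open>At least half of the support lies in \<open>Y\<close>, so twice a bound for
  \<open>Y\<close> on a conic or a line bounds the whole support.\<close>

lemma rel_supp_empty_of_bounds:
  assumes "rel d c" "card (supp c) < 3 * d" "card (supp c - Y) \<le> card (supp c \<inter> Y)" "finite Y"
    and conic: "\<And>Q. Q \<in> forms 2 \<Longrightarrow> Q \<noteq> 0 \<Longrightarrow> card {v \<in> Y. ev v Q = 0} \<le> d"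
    and line: "\<And>L. L \<in> forms 1 \<Longrightarrow> L \<noteq> 0 \<Longrightarrow> 2 * card {v \<in> Y. ev v L = 0} \<le> d + 1"
  shows "supp c = {}"
proof -
  have "card (supp c) = card (supp c \<inter> Y) + card (supp c - Y)"
    by (rule card_Int_Diff) simp
  then have *: "card (supp c) \<le> 2 * card (supp c \<inter> Y)" using assms(3) by simp
  have le: "card (supp c \<inter> Y) \<le> card {v \<in> Y. ev v F = 0}" if "\<forall>v\<in>supp c. ev v F = 0" for F
    using that assms(4) by (intro card_mono) auto
  obtain Q where Q: "Q \<in> forms 2" "Q \<noteq> 0" "\<forall>v\<in>supp c. ev v Q = 0"
    using rel_supp_conic[OF assms(1,2)] by blast
  have "card (supp c) \<le> 2 * d + 1" using * le[OF Q(3)] conic[OF Q(1,2)] by simp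
  then obtain L where L: "L \<in> forms 1" "L \<noteq> 0" "\<forall>v\<in>supp c. ev v L = 0"
    using rel_supp_collinear[OF assms(1)] by blast
  have "card (supp c) \<le> d + 1" using * le[OF L(3)] line[OF L(1,2)] by simp
  then show ?thesis by (rule rel_supp_empty[OF assms(1)])
qed

end

section \<open>Decompositions\<close>

lemma linear_forms_eq:
  assumes "L \<in> forms 1"
  shows "L = linear_form (\<lambda>j. Poly_Mapping.lookup L (Poly_Mapping.single j 1))"
proof (rule poly_mapping_eqI)
  fix e
  let ?L = "linear_form (\<lambda>j. Poly_Mapping.lookup L (Poly_Mapping.single j 1))"
  have L: "Poly_Mapping.lookup ?L e = (\<Sum>j\<in>UNIV. Poly_Mapping.lookup L (Poly_Mapping.single j 1)
      * (if Poly_Mapping.single j 1 = e then 1 else 0))"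
    unfolding linear_form_def lookup_sum var_def by (intro sum.cong refl) (simp add: lookup_single when_def)
  show "Poly_Mapping.lookup L e = Poly_Mapping.lookup ?L e"
  proof (cases "e \<in> exponents 1")
    case True
    then have "(\<Sum>j\<in>UNIV. Poly_Mapping.lookup e j) = 1" by (simp add: exponents_def)
    then have "\<exists>i\<in>UNIV. Poly_Mapping.lookup e i = 1 \<and> (\<forall>j\<in>UNIV. i \<noteq> j \<longrightarrow> Poly_Mapping.lookup e j = 0)"
      by (subst (asm) sum_eq_1_iff[OF finite])
    then obtain i where i: "Poly_Mapping.lookup e i = 1" "\<And>j. i \<noteq> j \<Longrightarrow> Poly_Mapping.lookup e j = 0"
      by blast
    have e: "e = Poly_Mapping.single i 1"
      by (rule poly_mapping_eqI) (use i in \<open>auto simp: lookup_single when_def\<close>)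
    have "Poly_Mapping.single j (1::nat) = Poly_Mapping.single i 1 \<longleftrightarrow> j = i" for j :: 'a
      by (auto dest: arg_cong[of _ _ "\<lambda>f. Poly_Mapping.lookup f j"] simp: lookup_single when_def split: if_splits)
    then have "Poly_Mapping.lookup ?L e = (\<Sum>j\<in>UNIV. if j = i then Poly_Mapping.lookup L (Poly_Mapping.single j 1) else 0)"
      unfolding L unfolding e by (intro sum.cong refl) (simp del: One_nat_def)
    then show ?thesis by (simp add: e)
  next
    case False
    then have "Poly_Mapping.lookup F e = 0" if "F \<in> forms 1" for F :: "'a cpoly"
      using that unfolding forms_iff in_keys_iff by (meson in_keys_iff subsetD)
    from this[OF assms] this[OF linear_form_forms] show ?thesis by simp
  qed
qed

text \<open>A chosen coordinate vector for each point, through which a set of points becomes a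
  \<open>point_set\<close>.\<close>

definition rep :: "('n::finite) cpoly set \<Rightarrow> 'n \<Rightarrow> complex"
  where "rep P = (SOME v. v \<noteq> (\<lambda>_. 0) \<and> P = cvs.span {linear_form v})"

lemma rep:
  assumes "P \<in> proj_points"
  shows "rep P \<noteq> (\<lambda>_. 0)" "P = cvs.span {linear_form (rep P)}"
proof -
  obtain L where L: "L \<in> forms 1" "L \<noteq> 0" "P = cvs.span {L}"
    using assms by (auto simp: proj_points_def proj_def)
  define v where "v = (\<lambda>j. Poly_Mapping.lookup L (Poly_Mapping.single j 1))"
  have "L = linear_form v" unfolding v_def by (rule linear_forms_eq[OF L(1)])
  moreover from this have "v \<noteq> (\<lambda>_. 0)" using L(2) by (auto simp: linear_form_def)
  ultimately have "\<exists>v. v \<noteq> (\<lambda>_. 0) \<and> P = cvs.span {linear_form v}" using L(3) by blast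
  from someI_ex[OF this] show "rep P \<noteq> (\<lambda>_. 0)" "P = cvs.span {linear_form (rep P)}"
    unfolding rep_def by blast+
qed

lemma inj_on_rep: "inj_on rep proj_points"
proof (rule inj_onI)
  fix P Q :: "'a cpoly set"
  assume P: "P \<in> proj_points" and Q: "Q \<in> proj_points" and "rep P = rep Q"
  then have "cvs.span {linear_form (rep P)} = cvs.span {linear_form (rep Q)}" by (simp only:)
  then show "P = Q" by (simp only: rep(2)[OF P, symmetric] rep(2)[OF Q, symmetric])
qed

lemma point_elements:
  assumes "P \<in> proj_points" "L \<in> P"
  shows "\<exists>c. L = cscale c (linear_form (rep P))"
proof -
  have "L \<in> cvs.span {linear_form (rep P)}"
    using assms(2) by (simp only: rep(2)[OF assms(1), symmetric])
  then show ?thesis unfolding cvs.span_singleton by blast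
qed

lemma point_set_rep:
  assumes "finite A" "A \<subseteq> (proj_points :: 3 cpoly set set)"
  shows "point_set (rep ` A)"
proof
  show "finite (rep ` A)" using assms by simp
  show "v \<noteq> (\<lambda>_. 0)" if "v \<in> rep ` A" for v
    using that assms(2) rep(1) by (auto dest: subsetD)
  fix u v c
  assume "u \<in> rep ` A" "v \<in> rep ` A" and v: "v = (\<lambda>j. c * u j)"
  then obtain P Q where P: "P \<in> proj_points" "u = rep P" and Q: "Q \<in> proj_points" "v = rep Q"
    using assms by blast
  have eq: "linear_form v = cscale c (linear_form u)" unfolding v by (rule linear_form_scale)
  have "c \<noteq> 0"
  proof
    assume "c = 0"
    then have "v = (\<lambda>_. 0)" using v by simp
    then show False using rep(1)[OF Q(1)] Q(2) by simp
  qed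
  then have eq': "linear_form u = cscale (1 / c) (linear_form v)" unfolding eq by simp
  have "linear_form v \<in> cvs.span {linear_form u}"
    unfolding eq by (intro cvs.span_scale cvs.span_base) simp
  moreover have "linear_form u \<in> cvs.span {linear_form v}"
    by (subst eq') (intro cvs.span_scale cvs.span_base, simp)
  ultimately have "cvs.span {linear_form u} = cvs.span {linear_form v}"
    by (simp add: cvs.span_eq)
  then have "P = Q"
    unfolding P(2) Q(2) by (simp only: rep(2)[OF P(1), symmetric] rep(2)[OF Q(1), symmetric])
  then show "u = v" using P(2) Q(2) by simp
qed

lemma span_image_sum:
  assumes "finite A" "x \<in> cvs.span (f ` A)"
  shows "\<exists>a. x = (\<Sum>i\<in>A. cscale (a i) (f i))"
  using assms(2)
proof (induction rule: cvs.span_induct_alt)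
  case base
  show ?case by (intro exI[of _ "\<lambda>_. 0"]) simp
next
  case (step c y z)
  obtain i where i: "i \<in> A" "y = f i" using step(1) by (rule imageE)
  obtain a where a: "z = (\<Sum>i\<in>A. cscale (a i) (f i))" using step(2) ..
  have "(\<Sum>j\<in>A. cscale (if j = i then c else 0) (f j)) = (\<Sum>j\<in>A. if j = i then cscale c (f j) else 0)"
    by (intro sum.cong) auto
  then have "(\<Sum>j\<in>A. cscale (if j = i then c else 0) (f j)) = cscale c y" using assms(1) i by simp
  then have "cscale c y + z = (\<Sum>j\<in>A. cscale ((if j = i then c else 0) + a j) (f j))"
    by (simp add: a cvs.scale_left_distrib sum.distrib)
  then show ?case by (intro exI[of _ "\<lambda>j. (if j = i then c else 0) + a j"])
qed

lemma power_in_veronese: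
  assumes "P \<in> proj_points"
  shows "linear_form (rep P) ^ d \<in> veronese d P"
proof -
  have "linear_form (rep P) \<in> cvs.span {linear_form (rep P)}" by (simp add: cvs.span_base)
  then have "linear_form (rep P) \<in> P" by (simp only: rep(2)[OF assms, symmetric])
  moreover have "linear_form (rep P) \<noteq> 0" using rep(1)[OF assms] by (rule linear_form_nonzero)
  ultimately have "linear_form (rep P) ^ d \<in> {L ^ d |L. L \<in> P \<and> L \<noteq> 0}"
    by (intro CollectI exI[of _ "linear_form (rep P)"] conjI refl)
  then show ?thesis unfolding veronese_def by (rule cvs.span_base)
qed

text \<open>Every representative of a point is a multiple of the chosen one, so its power is a
  multiple of the chosen power.\<close>

lemma veronese_span_eq:
  assumes "A \<subseteq> proj_points"
  shows "veronese_span d A = cvs.span ((\<lambda>P. linear_form (rep P) ^ d) ` A)"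
proof -
  let ?S = "(\<lambda>P. linear_form (rep P) ^ d) ` A"
  have "veronese d P \<subseteq> cvs.span ?S" if P: "P \<in> A" for P
    unfolding veronese_def
  proof (rule cvs.span_minimal[OF _ cvs.subspace_span], safe)
    fix L
    assume "L \<in> P"
    then obtain c where "L = cscale c (linear_form (rep P))"
      using point_elements[OF subsetD[OF assms P]] by blast
    then show "L ^ d \<in> cvs.span ?S" using P by (simp add: cscale_power cvs.span_scale cvs.span_base)
  qed
  then have "(\<Union>P\<in>A. veronese d P) \<subseteq> cvs.span ?S" by (rule UN_least)
  moreover have "?S \<subseteq> (\<Union>P\<in>A. veronese d P)"
  proof (rule image_subsetI)
    fix P
    assume "P \<in> A"
    then show "linear_form (rep P) ^ d \<in> (\<Union>P\<in>A. veronese d P)"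
      using power_in_veronese[of P d] assms by (intro UN_I[of P]) auto
  qed
  then have "?S \<subseteq> cvs.span (\<Union>P\<in>A. veronese d P)" using cvs.span_superset by (rule order.trans)
  ultimately show ?thesis unfolding veronese_span_def cvs.span_eq by (rule conjI)
qed

lemma decomposition_sum:
  assumes "decomposition d T A"
  shows "\<exists>a. T = (\<Sum>P\<in>A. cscale (a P) (linear_form (rep P) ^ d))"
proof (rule span_image_sum)
  show "finite A" using assms by (simp add: decomposition_def)
  have "A \<subseteq> proj_points" "T \<in> veronese_span d A" using assms by (simp_all add: decomposition_def)
  then show "T \<in> cvs.span ((\<lambda>P. linear_form (rep P) ^ d) ` A)" by (simp only: veronese_span_eq)
qed

text \<open>A zero coefficient would put \<open>T\<close> in the span belonging to the proper subset
  \<open>A - {P}\<close>.\<close>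

lemma non_redundant_coeff_nonzero:
  fixes A :: "('n::finite) cpoly set set"
  assumes "decomposition d T A" "non_redundant d T A"
    and T: "T = (\<Sum>P\<in>A. cscale (a P) (linear_form (rep P) ^ d))" and "P \<in> A"
  shows "a P \<noteq> 0"
proof
  assume "a P = 0"
  have A: "finite A" "A \<subseteq> proj_points" using assms(1) by (auto simp: decomposition_def)
  define g where "g Q = linear_form (rep Q) ^ d" for Q :: "'n cpoly set"
  have "T = (\<Sum>Q\<in>A - {P}. cscale (a Q) (g Q))"
    using T sum.remove[OF A(1) \<open>P \<in> A\<close>, of "\<lambda>Q. cscale (a Q) (g Q)"] \<open>a P = 0\<close>
    by (simp add: g_def)
  moreover have "(\<Sum>Q\<in>A - {P}. cscale (a Q) (g Q)) \<in> cvs.span (g ` (A - {P}))"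
  proof (rule cvs.span_sum)
    fix Q
    assume "Q \<in> A - {P}"
    then have "g Q \<in> g ` (A - {P})" by (rule imageI)
    then show "cscale (a Q) (g Q) \<in> cvs.span (g ` (A - {P}))"
      by (intro cvs.span_scale cvs.span_base)
  qed
  moreover have "veronese_span d (A - {P}) = cvs.span (g ` (A - {P}))"
    unfolding g_def by (rule veronese_span_eq) (use A(2) in blast)
  ultimately have "T \<in> veronese_span d (A - {P})" by simp
  moreover have "A - {P} \<noteq> A" using \<open>P \<in> A\<close> by (metis DiffD2 singletonI)
  from psubsetI[OF Diff_subset this] have "T \<notin> veronese_span d (A - {P})"
    using assms(2) unfolding non_redundant_def by (elim allE impE)
  ultimately show False by contradiction
qed

lemma terracini_independent:
  fixes A :: "3 cpoly set set"
  assumes A: "finite A" "A \<subseteq> proj_points"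
    and dim: "cvs.dim (terracini_space d A) = 3 * card A"
    and sum: "(\<Sum>P\<in>A. linear_form (s P) * linear_form (rep P) ^ (d - 1)) = 0" and "P \<in> A"
  shows "s P = (\<lambda>_. 0)"
proof (rule ccontr)
  assume "s P \<noteq> (\<lambda>_. 0)"
  then obtain i where i: "s P i \<noteq> 0" by auto
  define w :: "3 cpoly set \<times> 3 \<Rightarrow> 3 cpoly" where "w = (\<lambda>(P, j). var j * linear_form (rep P) ^ (d - 1))"
  define I where "I = A \<times> (UNIV :: 3 set)"
  define S where "S = w ` (I - {(P, i)})"
  have I: "finite I" "(P, i) \<in> I" "card I = 3 * card A"
    using A \<open>P \<in> A\<close> by (auto simp: I_def card_cartesian_product)
  have "0 = (\<Sum>(Q, j)\<in>I. cscale (s Q j) (w (Q, j)))"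
    unfolding I_def sum.cartesian_product[symmetric] sum[symmetric]
    by (simp add: linear_form_def w_def sum_distrib_right cscale_mult_left)
  also have "\<dots> = cscale (s P i) (w (P, i)) + (\<Sum>(Q, j)\<in>I - {(P, i)}. cscale (s Q j) (w (Q, j)))"
    by (simp add: sum.remove[OF I(1,2)])
  finally have "cscale (s P i) (w (P, i)) = - (\<Sum>(Q, j)\<in>I - {(P, i)}. cscale (s Q j) (w (Q, j)))"
    by (simp add: eq_neg_iff_add_eq_0)
  also have "\<dots> \<in> cvs.span S"
  proof (intro cvs.span_neg cvs.span_sum)
    fix x
    assume "x \<in> I - {(P, i)}"
    then have "w x \<in> cvs.span S" unfolding S_def by (intro cvs.span_base) blast
    then show "(case x of (Q, j) \<Rightarrow> cscale (s Q j) (w (Q, j))) \<in> cvs.span S"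
      by (cases x) (simp add: cvs.span_scale)
  qed
  finally have "cscale (1 / s P i) (cscale (s P i) (w (P, i))) \<in> cvs.span S"
    by (rule cvs.span_scale)
  then have "w (P, i) \<in> cvs.span S" using i by simp
  then have w: "w ` I \<subseteq> cvs.span S" unfolding S_def by (auto intro: cvs.span_base)
  have "terracini_space d A \<subseteq> cvs.span S"
    unfolding terracini_space_def tangent_space_def
  proof (rule cvs.span_minimal[OF _ cvs.subspace_span], rule UN_least, rule cvs.span_minimal[OF _ cvs.subspace_span], safe)
    fix Q j L
    assume Q: "Q \<in> A" and "L \<in> Q"
    then obtain c where c: "L = cscale c (linear_form (rep Q))"
      using point_elements[OF subsetD[OF A(2) Q]] by blast
    have "w (Q, j) \<in> cvs.span S" using w Q by (auto simp: I_def)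
    then show "var j * L ^ (d - 1) \<in> cvs.span S"
      unfolding c cscale_power cscale_mult_right w_def by (auto intro: cvs.span_scale)
  qed
  then have "3 * card A \<le> card S"
    unfolding dim[symmetric] by (rule cvs.dim_le_card) (simp add: S_def I)
  also have "\<dots> \<le> card (I - {(P, i)})" unfolding S_def using I by (intro card_image_le) simp
  also have "\<dots> < card I" using I by (intro card_Diff1_less)
  finally show False using I by simp
qed

lemma terracini_card_bound:
  fixes A :: "3 cpoly set set"
  assumes A: "finite A" "A \<subseteq> proj_points"
    and dim: "cvs.dim (terracini_space (Suc k) A) = 3 * card A"
    and q: "q \<in> forms m" "q \<noteq> 0" "p + m = Suc k"
  shows "2 * card {v \<in> rep ` A. ev v q = 0} + card (exponents p :: (3 \<Rightarrow>\<^sub>0 nat) set)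
    \<le> card (exponents (Suc k) :: (3 \<Rightarrow>\<^sub>0 nat) set)"
proof (rule terracini_bound[OF _ _ _ q])
  interpret point_set "rep ` A" by (rule point_set_rep[OF A])
  show "finite (rep ` A)" by (rule finite_X)
  show "v \<noteq> (\<lambda>_. 0)" if "v \<in> rep ` A" for v using nonzero[OF that] .
  fix s v
  assume sum: "(\<Sum>v\<in>rep ` A. linear_form (s v) * linear_form v ^ k) = 0" and v: "v \<in> rep ` A"
  have inj: "inj_on rep A" using inj_on_rep A(2) by (rule inj_on_subset)
  have "(\<Sum>P\<in>A. linear_form ((s \<circ> rep) P) * linear_form (rep P) ^ (Suc k - 1)) = 0"
    using sum by (simp add: sum.reindex[OF inj])
  from terracini_independent[OF A dim this] v show "s v = (\<lambda>_. 0)" by auto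
qed

text \<open>Two expressions of \<open>T\<close> differ by a relation whose support contains
  \<open>A - B\<close>. The bounds force it to be empty, so \<open>A \<subseteq> B\<close>, and the
  cardinalities give equality.\<close>

lemma unique_short_decomposition:
  fixes T :: "3 cpoly" and A B :: "3 cpoly set set"
  assumes A: "decomposition d T A" "non_redundant d T A"
    and dim: "cvs.dim (terracini_space d A) = 3 * card A"
    and "2 * card A < 3 * d" "2 \<le> d"
    and B: "decomposition d T B" "card B \<le> card A"
  shows "B = A"
proof -
  have fin: "finite A" "finite B" and pp: "A \<subseteq> proj_points" "B \<subseteq> proj_points"
    using A(1) B(1) by (auto simp: decomposition_def)
  obtain a where a: "T = (\<Sum>P\<in>A. cscale (a P) (linear_form (rep P) ^ d))"
    using decomposition_sum[OF A(1)] ..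
  obtain b where b: "T = (\<Sum>P\<in>B. cscale (b P) (linear_form (rep P) ^ d))"
    using decomposition_sum[OF B(1)] ..
  \<comment> \<open>The inverse of \<open>rep\<close>, used to read coefficients indexed by points
    as functions of vectors.\<close>
  define pt where "pt v = cvs.span {linear_form v}" for v :: "3 \<Rightarrow> complex"
  have pt: "pt (rep P) = P" if "P \<in> A \<union> B" for P
    unfolding pt_def using that pp by (intro rep(2)[symmetric]) blast
  define c where "c v = (if pt v \<in> A then a (pt v) else 0) - (if pt v \<in> B then b (pt v) else 0)" for v
  interpret point_set "rep ` (A \<union> B)" using fin pp by (intro point_set_rep) auto
  have inj: "inj_on rep (A \<union> B)" using inj_on_rep Un_least[OF pp] by (rule inj_on_subset)
  have "rel d c"
    unfolding rel_def
  proof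
    fix F :: "3 cpoly"
    assume F: "F \<in> forms d"
    have pairing_T: "pairing F T = fact d * (\<Sum>P\<in>A \<union> B. (if P \<in> C then x P else 0) * ev (rep P) F)"
      if "T = (\<Sum>P\<in>C. cscale (x P) (linear_form (rep P) ^ d))" "C \<subseteq> A \<union> B" for C x
    proof -
      have "pairing F T = fact d * (\<Sum>P\<in>C. x P * ev (rep P) F)"
        unfolding that(1) pairing_sum_right pairing_cscale_right pairing_power[OF F]
        by (simp add: sum_distrib_left mult_ac)
      also have "(\<Sum>P\<in>C. x P * ev (rep P) F) = (\<Sum>P\<in>A \<union> B. (if P \<in> C then x P else 0) * ev (rep P) F)"
        using that(2) fin by (intro sum.mono_neutral_cong_left) auto
      finally show ?thesis .
    qed
    have "(\<Sum>v\<in>rep ` (A \<union> B). c v * ev v F) = (\<Sum>P\<in>A \<union> B. c (rep P) * ev (rep P) F)"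
      by (simp add: sum.reindex[OF inj])
    also have "\<dots> = (\<Sum>P\<in>A \<union> B. (if P \<in> A then a P else 0) * ev (rep P) F
        - (if P \<in> B then b P else 0) * ev (rep P) F)"
      by (intro sum.cong refl) (simp add: c_def pt left_diff_distrib del: Un_iff)
    also have "\<dots> = 0"
      using pairing_T[OF a] pairing_T[OF b] by (simp add: sum_subtractf)
    finally show "(\<Sum>v\<in>rep ` (A \<union> B). c v * ev v F) = 0" .
  qed
  \<comment> \<open>Off \<open>B\<close> nothing can cancel, and non-redundancy makes the
    coefficient from \<open>A\<close> nonzero.\<close>
  have c_nonzero: "c (rep P) \<noteq> 0" if "P \<in> A - B" for P
    using that pt[of P] non_redundant_coeff_nonzero[OF A a, of P] by (simp add: c_def)
  obtain k where k: "d = Suc k" using assms(4) by (cases d) auto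
  note bound = terracini_card_bound[OF fin(1) pp(1) dim[unfolded k]]
  have "supp c = {}"
  proof (rule rel_supp_empty_of_bounds[OF \<open>rel d c\<close>])
    show "finite (rep ` A)" using fin by simp
    have "card (supp c) \<le> card (rep ` (A \<union> B))"
      by (rule card_mono[OF finite_X]) (auto simp: supp_def)
    also have "\<dots> \<le> card (A \<union> B)" using fin by (intro card_image_le) simp
    also have "\<dots> \<le> card A + card B" by (rule card_Un_le)
    finally show "card (supp c) < 3 * d" using assms(4) B(2) by simp
    have "card (supp c - rep ` A) \<le> card (rep ` (B - A))"
      using fin by (intro card_mono) (auto simp: supp_def)
    also have "\<dots> \<le> card (B - A)" using fin by (intro card_image_le) simp
    \<comment> \<open>The common points are removed from both sides of
      \<open>card B \<le> card A\<close>.\<close>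
    also have "\<dots> \<le> card (A - B)"
      using B(2) card_Int_Diff[OF fin(1), of B] card_Int_Diff[OF fin(2), of A] by (simp add: Int_commute)
    also have "\<dots> = card (rep ` (A - B))"
      by (rule card_image[symmetric, OF inj_on_subset[OF inj]]) blast
    also have "\<dots> \<le> card (supp c \<inter> rep ` A)"
      using c_nonzero by (intro card_mono finite_Int disjI1 finite_supp) (auto simp: supp_def)
    finally show "card (supp c - rep ` A) \<le> card (supp c \<inter> rep ` A)" .
    \<comment> \<open>Degrees \<open>k + 1\<close> and \<open>k\<close> differ by
      \<open>k + 2 = d + 1\<close> monomials.\<close>
    show "2 * card {v \<in> rep ` A. ev v L = 0} \<le> d + 1" if "L \<in> forms 1" "L \<noteq> 0" for L
      using bound[OF that, of k] card_exponents_Suc[of k] k by simp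
    \<comment> \<open>Degrees \<open>d\<close> and \<open>d - 2\<close> differ by
      \<open>2 * d + 1\<close> monomials; twice the cardinality is even, hence at most
      \<open>2 * d\<close>.\<close>
    show "card {v \<in> rep ` A. ev v Q = 0} \<le> d" if "Q \<in> forms 2" "Q \<noteq> 0" for Q
    proof -
      obtain m where m: "k = Suc m" using \<open>2 \<le> d\<close> k by (cases k) auto
      show ?thesis
        using bound[OF that, of m] card_exponents_Suc[of k] card_exponents_Suc[of m] k m by simp
    qed
  qed
  then have "A \<subseteq> B" using c_nonzero by (auto simp: supp_def)
  then show ?thesis using card_seteq[OF fin(2) _ B(2)] by simp
qed

theorem theorem4p5:
  fixes n d r :: nat
    and T :: "3 cpoly"
    and A :: "3 cpoly set set"
  assumes "d = 2 * n + 8"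
    and "T \<in> forms d" and "T \<noteq> 0"
    and "decomposition d T A" and "non_redundant d T A"
    and "r = card A" and "r \<le> 3 * n + 11"
    and "proj_dim (terracini_space d A) = 3 * int r - 1"
  shows "minimal_decomposition d T A \<and> form_rank d T = r \<and> identifiable d T"
proof -
  have "cvs.dim (terracini_space d A) = 3 * card A"
    using assms(6,8) by (simp add: proj_dim_def)
  \<comment> \<open>The strict inequality needed is
    \<open>2 * r \<le> 6 * n + 22 < 6 * n + 24 = 3 * d\<close>.\<close>
  then have unique: "B = A" if "decomposition d T B" "card B \<le> card A" for B
    using unique_short_decomposition[OF assms(4,5)] that assms(1,6,7) by simp
  have minimal: "minimal_decomposition d T A"
    unfolding minimal_decomposition_def using assms(4) unique by force
  have only: "B = A" if "minimal_decomposition d T B" for B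
    using that unique assms(4) unfolding minimal_decomposition_def by (meson not_le)
  have "form_rank d T = r"
    unfolding form_rank_def by (rule the_equality) (use minimal only assms(6) in blast)+
  moreover have "identifiable d T"
    unfolding identifiable_def using minimal only by blast
  ultimately show ?thesis using minimal by blast
qed

end
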